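(* Let $p\ge 1$ be an integer, and let $\mathcal{A}$ be a Borel set of $p\times p$ non-negative, allowable, column-stochastic matrices. Assume that $\mathcal{A}$ is primitive. Let $(A_n)_{n\ge 1}$ be an i.i.d. sequence of random matrices with values in $\mathcal{A}$, such that the distribution of $A_1$ is fully supported on $\mathcal{A}$. With $\alpha_n:=\min_{i,j}\{A_n^{i,j}: A_n^{i,j}\ne 0\}$, assume $\mathbb{E}\log^-\alpha_1>-\infty$. Let $x_0\in\mathbb{R}^p$, $w_0=\mathbf{1}$, $\bar x=\frac1p\sum_{i=1}^p x_0^i$, and for $n\ge 1$ let $x_n=A_nx_{n-1}$ and $w_n=A_nw_{n-1}$. Set $$\eta_2=\log\rho\left(\mathbb{E}(A_1^{\otimes 2})\,(I-J)^{\otimes 2}\right).$$ Then, almost surely, $$\limsup_{n\to\infty}\frac1n\log\sum_{i=1}^p\left|\frac{x_n^i}{w_n^i}-\bar x\right|\le\frac{\eta_2}{2}<0.$$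
   Context: A set $\mathcal{A}$ of $p\times p$ non-negative matrices is primitive if some finite product of elements of $\mathcal{A}$ (repetitions allowed) is strictly positive, i.e. has all entries $>0$. A non-negative matrix is allowable if every row and every column contains at least one strictly positive element. Column-stochastic means non-negative with all column sums equal to 1. The distribution $\mu$ of $A_1$ is fully supported on $\mathcal{A}$ if $\operatorname{supp}\mu=\mathcal{A}$, i.e. $\mu$ is a probability measure on $\mathcal{A}$ and every neighbourhood in $\mathcal{A}$ of every point of $\mathcal{A}$ has positive $\mu$-measure. $\log^- t=\min(\log t,0)$. $\mathbf{1}\in\mathbb{R}^p$ is the all-ones column vector, $I$ is the $p\times p$ identity matrix, $J=\mathbf{1}\mathbf{1}^\top/p$, $\otimes$ is the Kronecker (tensor) product, $S^{\otimes k}$ is the $k$-fold tensor power, and $\rho(\cdot)$ is the spectral radius. Superscript $i$ on a vector denotes its $i$-th coordinate. Convention: $\log 0=-\infty$. *)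

theory Defs
  imports "HOL-Probability.Probability"
begin

(* A matrix is a real ^ 'n ^ 'm; the entry with row i and column j is A $ i $ j. *)

definition nonneg_matrix :: "real ^ 'n ^ 'm \<Rightarrow> bool" where
  "nonneg_matrix A \<longleftrightarrow> (\<forall>i j. A $ i $ j \<ge> 0)"

definition allowable :: "real ^ 'n ^ 'm \<Rightarrow> bool" where
  "allowable A \<longleftrightarrow> (\<forall>i. \<exists>j. A $ i $ j > 0) \<and> (\<forall>j. \<exists>i. A $ i $ j > 0)"

definition column_stochastic :: "real ^ 'n ^ 'm \<Rightarrow> bool" where
  "column_stochastic A \<longleftrightarrow> nonneg_matrix A \<and> (\<forall>j. (\<Sum>i\<in>UNIV. A $ i $ j) = 1)"

definition primitive_set :: "(real ^ 'n ^ 'n) set \<Rightarrow> bool" where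
  "primitive_set S \<longleftrightarrow>
    (\<exists>As. As \<noteq> [] \<and> set As \<subseteq> S \<and> (\<forall>i j. foldr (**) As (mat 1) $ i $ j > 0))"

definition fully_supported :: "'a::topological_space measure \<Rightarrow> 'a set \<Rightarrow> bool" where
  "fully_supported \<mu> S \<longleftrightarrow>
    prob_space \<mu> \<and> S \<in> sets \<mu> \<and> emeasure \<mu> S = 1 \<and>
    (\<forall>x\<in>S. \<forall>U. open U \<longrightarrow> x \<in> U \<longrightarrow> emeasure \<mu> (U \<inter> S) > 0)"

definition min_nonzero_entry :: "real ^ 'n ^ 'm \<Rightarrow> real" where
  "min_nonzero_entry A = Min {A $ i $ j | i j. A $ i $ j \<noteq> 0}"

(* Only meant for t > 0: the library has ln 0 = 0. *)
definition log_minus :: "real \<Rightarrow> real" where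
  "log_minus t = min (ln t) 0"

(* The logarithm of a non-negative real, with log 0 = -\<infinity>. *)
definition ereal_log :: "real \<Rightarrow> ereal" where
  "ereal_log t = (if t > 0 then ereal (ln t) else -\<infinity>)"

definition kronecker :: "real ^ 'b ^ 'a \<Rightarrow> real ^ 'd ^ 'c \<Rightarrow> real ^ ('b \<times> 'd) ^ ('a \<times> 'c)" where
  "kronecker A B = (\<chi> r s. A $ fst r $ fst s * B $ snd r $ snd s)"

definition averaging_matrix :: "real ^ 'n ^ 'n" where
  "averaging_matrix = (\<chi> i j. 1 / real CARD('n))"

definition complex_eigenvalues :: "real ^ 'n ^ 'n \<Rightarrow> complex set" where
  "complex_eigenvalues A =
    {c. \<exists>v :: complex ^ 'n. v \<noteq> 0 \<and> map_matrix complex_of_real A *v v = c *s v}"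

definition spec_radius :: "real ^ 'n ^ 'n \<Rightarrow> real" where
  "spec_radius A = Max (cmod ` complex_eigenvalues A)"

primrec product_orbit :: "(nat \<Rightarrow> real ^ 'n ^ 'n) \<Rightarrow> real ^ 'n \<Rightarrow> nat \<Rightarrow> real ^ 'n" where
  "product_orbit A v 0 = v"
| "product_orbit A v (Suc n) = A (Suc n) *v product_orbit A v n"

end

theory Submission
  imports Defs "HOL-Computational_Algebra.Fundamental_Theorem_Algebra"
begin

text \<open>
  Put \<open>y\<^sub>0 = x\<^sub>0 - xbar \<cdot> 1\<close>, a vector with coordinate sum zero, and
  let \<open>y\<^sub>n\<close> and \<open>w\<^sub>n\<close> be its orbit and the orbit of the
  all-ones vector under the random products. By linearity
  \<open>x\<^sub>n = y\<^sub>n + xbar \<cdot> w\<^sub>n\<close>, so the \<open>i\<close>-th error is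
  exactly \<open>y\<^sub>n\<^sup>i / w\<^sub>n\<^sup>i\<close>. Two estimates give the rate: the
  numerators decay like \<open>exp (n \<eta>\<^sub>2 / 2)\<close>, and the denominators do not decay
  exponentially.

  Numerators. Column-stochasticity keeps the coordinate sum of \<open>y\<^sub>n\<close> at zero, so
  the centering matrix \<open>I - J\<close> fixes \<open>y\<^sub>n\<close>. By independence the
  matrix of second moments of \<open>y\<^sub>n\<close> is therefore obtained by applying
  \<open>E(A\<^sub>1 \<otimes> A\<^sub>1) (I - J) \<otimes> (I - J)\<close> to
  \<open>y\<^sub>0 \<otimes> y\<^sub>0\<close> exactly \<open>n\<close> times
  (\<open>orbit_second_moment\<close>). The iterates of a matrix with spectral radius below
  \<open>r\<close> are \<open>O(r^n)\<close> (\<open>matrix_iterates_growth\<close>), and Markov's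
  inequality with the Borel-Cantelli lemma turns the bound on the mean square into an almost sure
  one (\<open>orbit_decay\<close>).

  Denominators. Write a strictly positive product of members of the set as
  \<open>B\<^sub>1 \<dots> B\<^sub>k\<close>. By full support there is a positive probability that
  \<open>k\<close> consecutive matrices fall into small neighbourhoods of
  \<open>B\<^sub>k, \<dots>, B\<^sub>1\<close>. Such a window spreads the total mass
  \<open>p\<close>, which is conserved, over all coordinates, and so bounds all coordinates of
  \<open>w\<close> below by a constant. After the last window, each further matrix costs at most a
  factor equal to its least nonzero entry, since allowability gives every row a nonzero entry. Hence
  \<open>- log min w\<^sub>n\<close> is at most a constant plus the sum of
  \<open>- log \<alpha>\<^sub>i\<close> over the times \<open>i\<close> after which no window has
  been completed. A time \<open>j\<close> steps in the past contributes only if no window occurred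
  during these \<open>j\<close> steps, an event which is independent of
  \<open>\<alpha>\<^sub>i\<close> and has probability \<open>O(\<gamma>^j)\<close> for some
  \<open>\<gamma> < 1\<close>; a union bound with geometric weights then needs only the first moment
  of \<open>log \<alpha>\<^sub>1\<close> to make the sum \<open>o(n)\<close>
  (\<open>gap_sum_sublinear\<close>, \<open>weights_subexponential\<close>).

  Negativity of \<open>\<eta>\<^sub>2\<close>. An eigenvector of the projected operator for a
  nonzero eigenvalue has zero marginals, so it is an eigenvector of
  \<open>T = E(A\<^sub>1 \<otimes> A\<^sub>1)\<close> with sum zero. Now \<open>T\<close> is
  column-stochastic, and by primitivity and full support some power of it is strictly positive. A
  strictly positive stochastic matrix strictly contracts the \<open>l\<^sup>1\<close> norm on
  vectors of sum zero, so the eigenvalue lies inside the unit disc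
  (\<open>spec_radius_projected_less_1\<close>).
\<close>

section \<open>Growth of matrix iterates\<close>

definition poly_act :: "complex poly \<Rightarrow> complex ^ 'n ^ 'n \<Rightarrow> complex ^ 'n \<Rightarrow> complex ^ 'n" where
  "poly_act q M v = (\<Sum>i\<le>degree q. coeff q i *s (((*v) M) ^^ i) v)"

definition is_eigenvalue :: "complex ^ 'n ^ 'n \<Rightarrow> complex \<Rightarrow> bool" where
  "is_eigenvalue M c \<longleftrightarrow> (\<exists>v. v \<noteq> 0 \<and> M *v v = c *s v)"

lemma poly_act_altdef:
  assumes "degree q \<le> n"
  shows "poly_act q M v = (\<Sum>i\<le>n. coeff q i *s (((*v) M) ^^ i) v)"
  unfolding poly_act_def
  by (rule sum.mono_neutral_left) (use assms in \<open>auto simp: coeff_eq_0\<close>)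

lemma poly_act_add: "poly_act (p + q) M v = poly_act p M v + poly_act q M v"
proof -
  let ?n = "max (degree p) (degree q)"
  have "degree (p + q) \<le> ?n" by (rule degree_add_le) auto
  then show ?thesis
    by (simp add: poly_act_altdef[of _ ?n] sum.distrib vec.scale_left_distrib)
qed

lemma poly_act_smult: "poly_act (smult c q) M v = c *s poly_act q M v"
  by (simp add: poly_act_altdef[of _ "degree q"] degree_smult_le vec.scale_sum_right)

lemma funpow_matrix_add:
  "(((*v) (M :: complex ^ 'n ^ 'n)) ^^ i) (u + v) = (((*v) M) ^^ i) u + (((*v) M) ^^ i) v"
  by (induction i) (auto simp: matrix_vector_right_distrib)

lemma funpow_matrix_scale:
  "(((*v) (M :: complex ^ 'n ^ 'n)) ^^ i) (c *s v) = c *s (((*v) M) ^^ i) v"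
  by (induction i) (auto simp: vector_scalar_commute)

lemma funpow_matrix_0: "(((*v) (M :: complex ^ 'n ^ 'n)) ^^ i) 0 = 0"
  by (induction i) auto

lemma poly_act_pCons_0: "poly_act (pCons 0 q) M v = M *v poly_act q M v"
proof -
  have "poly_act (pCons 0 q) M v = (\<Sum>i\<le>Suc (degree q). coeff (pCons 0 q) i *s (((*v) M) ^^ i) v)"
    by (rule poly_act_altdef) (rule degree_pCons_le)
  also have "\<dots> = (\<Sum>i\<le>degree q. coeff q i *s (M *v (((*v) M) ^^ i) v))"
    by (subst sum.atMost_Suc_shift) simp
  also have "\<dots> = M *v poly_act q M v"
    unfolding poly_act_def by (simp add: vec.sum vector_scalar_commute)
  finally show ?thesis .
qed

lemma poly_act_linear_factor:
  "poly_act ([:- c, 1:] * q) M v = M *v poly_act q M v - c *s poly_act q M v"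
proof -
  have "[:- c, 1:] * q = smult (- c) q + pCons 0 q" by simp
  then show ?thesis
    by (simp only: poly_act_add poly_act_smult poly_act_pCons_0) simp
qed

lemma poly_act_commute:
  "poly_act q M (M *v v - c *s v) = M *v poly_act q M v - c *s poly_act q M v"
proof -
  have "(((*v) M) ^^ i) (M *v v - c *s v) = M *v (((*v) M) ^^ i) v - c *s (((*v) M) ^^ i) v" for i
  proof -
    have "(((*v) M) ^^ i) (M *v v) = M *v (((*v) M) ^^ i) v"
      by (rule funpow_swap1[symmetric])
    then show ?thesis
      using funpow_matrix_add[of i M "M *v v" "(- c) *s v"] funpow_matrix_scale[of i M "- c" v]
      by simp
  qed
  then show ?thesis
    unfolding poly_act_def
    by (simp add: vec.sum vec.scale_sum_right vector_scalar_commute vec.scale_right_diff_distrib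
        sum_subtractf mult.commute)
qed

lemma poly_act_eigenvector:
  assumes "M *v v = c *s v"
  shows "poly_act q M v = poly q c *s v"
proof -
  have "(((*v) M) ^^ i) v = c ^ i *s v" for i
    by (induction i) (auto simp: vector_scalar_commute assms mult.commute)
  then show ?thesis
    unfolding poly_act_def poly_altdef by (simp add: vec.scale_sum_left)
qed

text \<open>
  Any \<open>dim + 1\<close> vectors satisfy a linear relation. Repetitions in the sequence are
  harmless here, whereas linear dependence of its set of values would not see them.
\<close>

lemma linear_relation_of_sequence:
  fixes g :: "nat \<Rightarrow> 'a::euclidean_space"
  shows "\<exists>n u. (\<exists>i\<le>n. u i \<noteq> 0) \<and> (\<Sum>i\<le>n. u i *\<^sub>R g i) = 0"
proof (cases "inj_on g {..DIM('a)}")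
  case True
  then have "dependent (g ` {..DIM('a)})"
    by (intro dependent_biggerset) (auto simp: card_image)
  then obtain u where u: "\<exists>v\<in>g ` {..DIM('a)}. u v \<noteq> 0" "(\<Sum>v\<in>g ` {..DIM('a)}. u v *\<^sub>R v) = 0"
    by (subst (asm) dependent_finite) auto
  with True show ?thesis
    by (intro exI[of _ "DIM('a)"] exI[of _ "u \<circ> g"]) (auto simp: sum.reindex)
next
  case False
  then obtain i j where ij: "i \<le> DIM('a)" "j \<le> DIM('a)" "i \<noteq> j" "g i = g j"
    by (auto simp: inj_on_def)
  let ?u = "\<lambda>k. (if k = i then 1 else 0) - (if k = j then 1 else 0 :: real)"
  have "(\<Sum>k\<le>DIM('a). ?u k *\<^sub>R g k) = 0"
    using ij by (simp add: scaleR_left_diff_distrib sum_subtractf if_distrib[of "\<lambda>c. c *\<^sub>R _"] cong: if_cong)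
  then show ?thesis
    using ij by (intro exI[of _ "DIM('a)"] exI[of _ ?u]) auto
qed

text \<open>
  A weak substitute for the Cayley-Hamilton theorem: the powers of \<open>M\<close> live in a
  finite-dimensional space and hence are linearly related. The relation has real coefficients,
  because the space of matrices is taken as a real Euclidean space.
\<close>

lemma annihilating_poly_exists:
  fixes M :: "complex ^ 'n ^ 'n"
  shows "\<exists>q. q \<noteq> 0 \<and> (\<forall>v. poly_act q M v = 0)"
proof -
  obtain n u where u: "\<exists>i\<le>n. u i \<noteq> 0" "(\<Sum>i\<le>n. u i *\<^sub>R ((((**) M) ^^ i) (mat 1))) = 0"
    using linear_relation_of_sequence[of "\<lambda>i. (((**) M) ^^ i) (mat 1)"] by blast
  define q where "q = (\<Sum>i\<le>n. monom (complex_of_real (u i)) i)"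
  have cq: "coeff q i = (if i \<le> n then complex_of_real (u i) else 0)" for i
    by (auto simp: q_def coeff_sum)
  then have "degree q \<le> n" by (intro degree_le) auto
  have pw: "((((**) M) ^^ i) (mat 1)) *v v = (((*v) M) ^^ i) v" for i v
    by (induction i) (auto simp: matrix_vector_mul_assoc[symmetric])
  have "poly_act q M v = 0" for v
  proof -
    have "poly_act q M v = (\<Sum>i\<le>n. complex_of_real (u i) *s (((((**) M) ^^ i) (mat 1)) *v v))"
      by (simp add: poly_act_altdef[OF \<open>degree q \<le> n\<close>] cq pw)
    also have "\<dots> = (\<Sum>i\<le>n. (u i *\<^sub>R ((((**) M) ^^ i) (mat 1))) *v v)"
      by (intro sum.cong refl)
        (simp add: vec_eq_iff matrix_vector_mult_def scaleR_conv_of_real[where 'a = complex] sum_distrib_left mult.assoc)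
    also have "\<dots> = (\<Sum>i\<le>n. u i *\<^sub>R ((((**) M) ^^ i) (mat 1))) *v v"
      by (simp add: vec_eq_iff matrix_vector_mult_def sum_distrib_right) (subst sum.swap, simp)
    finally show ?thesis using u by simp
  qed
  moreover from u obtain i where "i \<le> n" "u i \<noteq> 0" by auto
  then have "q \<noteq> 0" using cq[of i] by (metis coeff_0 of_real_eq_0_iff)
  ultimately show ?thesis by blast
qed

text \<open>
  This replaces the Jordan normal form. Factor an annihilating polynomial of \<open>v\<close> into
  linear factors \<open>M - c\<close>. A factor in which \<open>c\<close> is an eigenvalue is
  handled by the induction step; all other factors are injective and can be cancelled. So any
  property that propagates from \<open>(M - c) v\<close> to \<open>v\<close> for eigenvalues
  \<open>c\<close> holds everywhere as soon as it holds at zero.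
\<close>

lemma generalized_eigenvector_induct:
  fixes M :: "complex ^ 'n ^ 'n"
  assumes zero: "P 0"
    and step: "\<And>c v. is_eigenvalue M c \<Longrightarrow> P (M *v v - c *s v) \<Longrightarrow> P v"
  shows "P v"
proof -
  obtain q where q: "q \<noteq> 0" "poly_act q M v = 0"
    using annihilating_poly_exists by blast
  then show ?thesis
  proof (induction "degree q" arbitrary: q v)
    case 0
    then obtain a where "q = [:a:]" "a \<noteq> 0"
      by (metis degree_eq_zeroE pCons_0_0)
    with 0 have "v = 0" by (simp add: poly_act_def)
    then show ?case using zero by simp
  next
    case (Suc d)
    then have "\<not> constant (poly q)" by (simp add: constant_degree)
    then obtain c where "poly q c = 0" using fundamental_theorem_of_algebra by blast
    then obtain p where p: "q = [:- c, 1:] * p" by (metis dvdE poly_eq_0_iff_dvd)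
    with Suc.prems have "p \<noteq> 0" by auto
    with p Suc.hyps have deg: "d = degree p" by (simp add: degree_mult_eq del: mult_pCons_left)
    have fac: "M *v poly_act p M v - c *s poly_act p M v = 0"
      using Suc.prems p poly_act_linear_factor by metis
    show ?case
    proof (cases "is_eigenvalue M c")
      case True
      have "poly_act p M (M *v v - c *s v) = 0"
        using fac by (simp add: poly_act_commute)
      then show ?thesis
        using step[OF True] Suc.hyps(1)[OF deg \<open>p \<noteq> 0\<close>] by blast
    next
      case False
      with fac have "poly_act p M v = 0" unfolding is_eigenvalue_def by auto
      then show ?thesis using Suc.hyps(1)[OF deg \<open>p \<noteq> 0\<close>] by blast
    qed
  qed
qed

lemma finite_eigenvalues: "finite {c. is_eigenvalue (M :: complex ^ 'n ^ 'n) c}"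
proof -
  obtain q where q: "q \<noteq> 0" "\<And>v. poly_act q M v = 0"
    using annihilating_poly_exists by blast
  have "{c. is_eigenvalue M c} \<subseteq> {c. poly q c = 0}"
  proof safe
    fix c
    assume "is_eigenvalue M c"
    then obtain v where "v \<noteq> 0" "M *v v = c *s v" by (auto simp: is_eigenvalue_def)
    with q(2)[of v] show "poly q c = 0" by (simp add: poly_act_eigenvector)
  qed
  then show ?thesis using poly_roots_finite[OF q(1)] finite_subset by blast
qed

text \<open>
  Without eigenvalues the induction step above would be vacuous, and every vector would be zero.
\<close>

lemma eigenvalue_exists: "\<exists>c. is_eigenvalue (M :: complex ^ 'n ^ 'n) c"
proof (rule ccontr)
  assume none: "\<nexists>c. is_eigenvalue M c"
  have "v = 0" for v :: "complex ^ 'n"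
    by (rule generalized_eigenvector_induct[of "\<lambda>v. v = 0" M]) (use none in auto)
  from this[of "\<chi> i. 1"] show False by (simp add: vec_eq_iff)
qed

lemma norm_vector_scalar_mult: "norm (c *s (v :: complex ^ 'n)) = cmod c * norm v"
  by (simp add: norm_vec_def norm_mult L2_set_right_distrib)

text \<open>
  If \<open>u = (M - c) v\<close> then \<open>M^(n+1) v = c (M^n v) + M^n u\<close>, an
  inhomogeneous first-order recurrence with \<open>|c| < r\<close> and forcing term
  \<open>O(r^n)\<close>, so \<open>M^n v\<close> is \<open>O(r^n)\<close> if \<open>M^n u\<close>
  is. The requirement that \<open>r\<close> exceed the moduli of the eigenvalues strictly rules out
  the polynomial factors of nontrivial Jordan blocks.
\<close>

lemma matrix_iterates_growth:
  fixes M :: "complex ^ 'n ^ 'n"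
  assumes r: "\<And>c. is_eigenvalue M c \<Longrightarrow> cmod c < r"
  shows "\<exists>C. \<forall>n. norm ((((*v) M) ^^ n) v) \<le> C * r ^ n"
proof (induction v rule: generalized_eigenvector_induct[of _ M])
  case 1
  show ?case by (auto simp: funpow_matrix_0 intro!: exI[of _ 0])
next
  case (2 c v)
  then obtain C where C: "\<And>n. norm ((((*v) M) ^^ n) (M *v v - c *s v)) \<le> C * r ^ n" by blast
  have c: "cmod c < r" by (rule r) fact
  then have r0: "r > 0" using norm_ge_zero[of c] by linarith
  \<comment> \<open>the least constant that covers \<open>n = 0\<close> and satisfies \<open>C + |c| D \<le> r D\<close>\<close>
  define D where "D = max (norm v) (C / (r - cmod c))"
  have "C = C / (r - cmod c) * (r - cmod c)" using c by simp
  also have "\<dots> \<le> D * (r - cmod c)"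
    using c by (intro mult_right_mono) (auto simp: D_def)
  finally have D: "C + cmod c * D \<le> D * r" by (simp add: algebra_simps)
  have "norm ((((*v) M) ^^ n) v) \<le> D * r ^ n" for n
  proof (induction n)
    case 0
    show ?case by (simp add: D_def)
  next
    case (Suc n)
    have "(((*v) M) ^^ n) (M *v v) = (((*v) M) ^^ n) (M *v v - c *s v) + c *s (((*v) M) ^^ n) v"
      by (simp add: funpow_matrix_add[symmetric] funpow_matrix_scale[symmetric])
    then have "norm ((((*v) M) ^^ Suc n) v)
        \<le> norm ((((*v) M) ^^ n) (M *v v - c *s v)) + norm (c *s (((*v) M) ^^ n) v)"
      by (simp only: funpow_Suc_right o_apply) (rule norm_triangle_ineq)
    also have "\<dots> \<le> C * r ^ n + cmod c * (D * r ^ n)"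
      using Suc.IH C[of n] by (intro add_mono) (auto simp: norm_vector_scalar_mult intro!: mult_left_mono)
    also have "\<dots> = (C + cmod c * D) * r ^ n" by (simp add: algebra_simps)
    also have "\<dots> \<le> (D * r) * r ^ n" using D r0 by (intro mult_right_mono) auto
    finally show ?case by (simp add: mult_ac)
  qed
  then show ?case by blast
qed

lemma complex_eigenvalues_iff:
  "c \<in> complex_eigenvalues M \<longleftrightarrow> is_eigenvalue (map_matrix complex_of_real M) c"
  by (simp add: complex_eigenvalues_def is_eigenvalue_def)

lemma finite_complex_eigenvalues: "finite (complex_eigenvalues M)"
  using finite_eigenvalues[of "map_matrix complex_of_real M"]
  by (simp add: complex_eigenvalues_iff[symmetric])

lemma spec_radius_ge: "c \<in> complex_eigenvalues M \<Longrightarrow> cmod c \<le> spec_radius M"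
  unfolding spec_radius_def by (intro Max_ge) (auto simp: finite_complex_eigenvalues)

lemma spec_radius_attained: "\<exists>c\<in>complex_eigenvalues M. spec_radius M = cmod c"
proof -
  have "complex_eigenvalues M \<noteq> {}"
    using eigenvalue_exists[of "map_matrix complex_of_real M"] by (auto simp: complex_eigenvalues_iff)
  then have "Max (cmod ` complex_eigenvalues M) \<in> cmod ` complex_eigenvalues M"
    by (intro Max_in) (auto simp: finite_complex_eigenvalues)
  then show ?thesis unfolding spec_radius_def by auto
qed

lemma spec_radius_nonneg: "spec_radius M \<ge> 0"
  using spec_radius_attained[of M] by auto

lemma real_matrix_iterates_growth:
  fixes M :: "real ^ 'n ^ 'n"
  assumes "spec_radius M < r"
  shows "\<exists>C. \<forall>n i. \<bar>(((*v) M) ^^ n) v $ i\<bar> \<le> C * r ^ n"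
proof -
  let ?c = "\<lambda>v::real^'n. \<chi> i. complex_of_real (v $ i)"
  have "\<exists>C. \<forall>n. norm ((((*v) (map_matrix complex_of_real M)) ^^ n) (?c v)) \<le> C * r ^ n"
    by (rule matrix_iterates_growth)
      (use assms spec_radius_ge in \<open>fastforce simp: complex_eigenvalues_iff\<close>)
  then obtain C where C: "\<And>n. norm ((((*v) (map_matrix complex_of_real M)) ^^ n) (?c v)) \<le> C * r ^ n" 
    by blast
  have "(((*v) (map_matrix complex_of_real M)) ^^ n) (?c v) = ?c ((((*v) M) ^^ n) v)" for n
    by (induction n) (auto simp: vec_eq_iff matrix_vector_mult_def)
  then have "\<bar>(((*v) M) ^^ n) v $ i\<bar> \<le> C * r ^ n" for n i
    using order_trans[OF Finite_Cartesian_Product.norm_nth_le C[of n], of i] by simp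
  then show ?thesis by blast
qed

section \<open>Stochastic matrices and the projected Kronecker square\<close>

lemma sum_UNIV_prod:
  fixes f :: "'a::finite \<times> 'b::finite \<Rightarrow> 'c::comm_monoid_add"
  shows "(\<Sum>s\<in>UNIV. f s) = (\<Sum>k\<in>UNIV. \<Sum>l\<in>UNIV. f (k, l))"
  by (simp add: sum.cartesian_product)

lemma column_stochastic_mat_1: "column_stochastic (mat 1 :: real ^ 'n ^ 'n)"
  by (auto simp: column_stochastic_def nonneg_matrix_def mat_def)

lemma column_stochastic_mult:
  fixes A B :: "real ^ 'n ^ 'n"
  assumes "column_stochastic A" "column_stochastic B"
  shows "column_stochastic (A ** B)"
proof -
  have "(\<Sum>i\<in>UNIV. (A ** B) $ i $ j) = (\<Sum>k\<in>UNIV. (\<Sum>i\<in>UNIV. A $ i $ k) * B $ k $ j)" for j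
    by (simp add: matrix_matrix_mult_def sum_distrib_right) (rule sum.swap)
  then show ?thesis
    using assms by (auto simp: column_stochastic_def nonneg_matrix_def matrix_matrix_mult_def
        intro!: sum_nonneg)
qed

lemma column_stochastic_entry_le_1:
  assumes "column_stochastic A"
  shows "0 \<le> A $ i $ j" "A $ i $ j \<le> 1"
proof -
  show nn: "0 \<le> A $ i $ j" for i j
    using assms by (simp add: column_stochastic_def nonneg_matrix_def)
  have "A $ i $ j \<le> (\<Sum>i\<in>UNIV. A $ i $ j)" by (rule member_le_sum) (auto simp: nn)
  also have "\<dots> = 1" using assms by (simp add: column_stochastic_def)
  finally show "A $ i $ j \<le> 1" .
qed

lemma positive_matrix_bounded_below:
  fixes Q :: "real ^ 'n ^ 'm"
  assumes pos: "\<And>i j. 0 < Q $ i $ j"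
  obtains d where "0 < d" "\<And>i j. d \<le> Q $ i $ j"
proof
  let ?R = "range (\<lambda>(i, j). Q $ i $ j)"
  show "0 < Min ?R" using pos by (subst Min_gr_iff) auto
  show "Min ?R \<le> Q $ i $ j" for i j by (rule Min_le) auto
qed

text \<open>
  Doeblin's argument: on vectors of sum zero, subtracting the constant \<open>d\<close> from every
  entry of \<open>Q\<close> does not change \<open>Q v\<close>, but lowers every column sum to
  \<open>1 - n d\<close>, so \<open>Q\<close> contracts the \<open>l\<^sup>1\<close> norm by that
  factor.
\<close>

lemma positive_stochastic_contracts:
  fixes Q :: "real ^ 'n ^ 'n" and v :: "complex ^ 'n"
  assumes Q: "column_stochastic Q" and pos: "\<And>i j. 0 < Q $ i $ j"
    and v: "(\<Sum>i\<in>UNIV. v $ i) = 0" "v \<noteq> 0"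
    and ev: "map_matrix complex_of_real Q *v v = c *s v"
  shows "cmod c < 1"
proof -
  obtain d where d: "0 < d" "\<And>i j. d \<le> Q $ i $ j"
    using positive_matrix_bounded_below[of Q] pos by blast
  define N where "N = (\<Sum>j\<in>UNIV. cmod (v $ j))"
  have "v $ i = 0 " if "N = 0" for i
    using that by (simp add: N_def sum_nonneg_eq_0_iff)
  with v(2) have "N \<noteq> 0" by (auto simp: vec_eq_iff)
  then have N: "N > 0" using sum_nonneg[of UNIV "\<lambda>j. cmod (v $ j)"] by (simp add: N_def)
  have row: "cmod c * cmod (v $ i) \<le> (\<Sum>j\<in>UNIV. (Q $ i $ j - d) * cmod (v $ j))" for i
  proof -
    have "c * v $ i = (\<Sum>j\<in>UNIV. complex_of_real (Q $ i $ j) * v $ j)"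
      using arg_cong[OF ev, of "\<lambda>u. u $ i"] by (simp add: matrix_vector_mult_def)
    also have "\<dots> = (\<Sum>j\<in>UNIV. complex_of_real (Q $ i $ j - d) * v $ j)"
      using v(1) by (simp add: left_diff_distrib sum_subtractf sum_distrib_left[symmetric])
    finally have "cmod c * cmod (v $ i) = cmod (\<Sum>j\<in>UNIV. complex_of_real (Q $ i $ j - d) * v $ j)"
      by (metis norm_mult)
    also have "\<dots> \<le> (\<Sum>j\<in>UNIV. cmod (complex_of_real (Q $ i $ j - d) * v $ j))"
      by (rule norm_sum)
    also have "\<dots> = (\<Sum>j\<in>UNIV. (Q $ i $ j - d) * cmod (v $ j))"
      using d(2) by (intro sum.cong refl) (simp only: norm_mult norm_of_real, simp)
    finally show ?thesis .
  qed
  have "cmod c * N \<le> (\<Sum>i\<in>UNIV. \<Sum>j\<in>UNIV. (Q $ i $ j - d) * cmod (v $ j))"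
    unfolding N_def sum_distrib_left by (rule sum_mono) (rule row)
  also have "\<dots> = (\<Sum>j\<in>UNIV. (\<Sum>i\<in>UNIV. Q $ i $ j - d) * cmod (v $ j))"
    by (subst sum.swap) (simp add: sum_distrib_right)
  also have "\<dots> = (1 - real CARD('n) * d) * N"
    using Q by (simp add: sum_subtractf column_stochastic_def N_def sum_distrib_left)
  finally have "cmod c \<le> 1 - real CARD('n) * d" using N by simp
  also have "\<dots> < 1" using d(1) by simp
  finally show ?thesis .
qed

definition matrix_pow :: "real ^ 'n ^ 'n \<Rightarrow> nat \<Rightarrow> real ^ 'n ^ 'n" where
  "matrix_pow T n = (((**) T) ^^ n) (mat 1)"

lemma matrix_pow_0: "matrix_pow T 0 = mat 1"
  and matrix_pow_Suc: "matrix_pow T (Suc n) = T ** matrix_pow T n"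
  by (simp_all add: matrix_pow_def)

lemma column_stochastic_pow: "column_stochastic T \<Longrightarrow> column_stochastic (matrix_pow T n)"
  by (induction n) (auto simp: matrix_pow_0 matrix_pow_Suc column_stochastic_mat_1 column_stochastic_mult)

lemma matrix_pow_eigenvector:
  assumes "map_matrix complex_of_real T *v v = c *s v"
  shows "map_matrix complex_of_real (matrix_pow T n) *v v = c ^ n *s v"
proof (induction n)
  case 0
  have "map_matrix complex_of_real (mat 1 :: real ^ 'a ^ 'a) = mat 1"
    by (simp add: vec_eq_iff mat_def)
  then show ?case by (simp add: matrix_pow_0)
next
  case (Suc n)
  have "map_matrix complex_of_real (T ** matrix_pow T n)
      = map_matrix complex_of_real T ** map_matrix complex_of_real (matrix_pow T n)"
    by (simp add: vec_eq_iff matrix_matrix_mult_def)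
  then show ?case
    by (simp add: matrix_pow_Suc matrix_vector_mul_assoc[symmetric] Suc.IH vector_scalar_commute assms
        mult.commute)
qed

text \<open>
  Only supports matter: a path through positive entries of the factors in \<open>As\<close>, taken
  for both coordinates at once, is a path through positive entries of \<open>T\<close>.
\<close>

lemma kronecker_power_positive:
  fixes T :: "real ^ ('p::finite \<times> 'p) ^ ('p \<times> 'p)"
  assumes T: "column_stochastic T"
    and supp: "\<And>B i k i' k'. B \<in> S \<Longrightarrow> B $ i $ k > 0 \<Longrightarrow> B $ i' $ k' > 0 \<Longrightarrow> T $ (i, i') $ (k, k') > 0"
    and nn: "\<And>B. B \<in> S \<Longrightarrow> nonneg_matrix B"
    and As: "set As \<subseteq> S"
    and P: "foldr (**) As (mat 1) $ i $ j > 0" "foldr (**) As (mat 1) $ i' $ j' > 0"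
  shows "matrix_pow T (length As) $ (i, i') $ (j, j') > 0"
  using As P
proof (induction As arbitrary: i i')
  case Nil
  then show ?case by (auto simp: matrix_pow_0 mat_def split: if_splits)
next
  case (Cons B As)
  let ?P = "foldr (**) As (mat 1)"
  have step: "\<exists>k. B $ i $ k > 0 \<and> ?P $ k $ j > 0" if "(B ** ?P) $ i $ j > 0" for i j
  proof -
    from that obtain k where k: "B $ i $ k * ?P $ k $ j > 0"
      by (metis (no_types, lifting) matrix_matrix_mult_def vec_lambda_beta sum_nonpos not_less)
    have "B $ i $ k \<ge> 0" using Cons.prems(1) nn[of B] by (auto simp: nonneg_matrix_def)
    with k show ?thesis by (auto simp: zero_less_mult_iff)
  qed
  from step Cons.prems(2) obtain k where k: "B $ i $ k > 0" "?P $ k $ j > 0" by auto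
  from step Cons.prems(3) obtain k' where k': "B $ i' $ k' > 0" "?P $ k' $ j' > 0" by auto
  have IH: "matrix_pow T (length As) $ (k, k') $ (j, j') > 0"
    using Cons.IH Cons.prems(1) k k' by auto
  have T1: "T $ (i, i') $ (k, k') > 0"
    using supp Cons.prems(1) k k' by auto
  have "0 < T $ (i, i') $ (k, k') * matrix_pow T (length As) $ (k, k') $ (j, j')"
    using IH T1 by simp
  also have "\<dots> \<le> (\<Sum>s\<in>UNIV. T $ (i, i') $ s * matrix_pow T (length As) $ s $ (j, j'))"
    by (rule member_le_sum)
      (auto intro!: mult_nonneg_nonneg column_stochastic_entry_le_1 T column_stochastic_pow)
  finally show ?case by (simp add: matrix_pow_Suc matrix_matrix_mult_def)
qed

abbreviation (input) pair_projection :: "real ^ ('p::finite \<times> 'p) ^ ('p \<times> 'p)" where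
  "pair_projection \<equiv> kronecker (mat 1 - averaging_matrix) (mat 1 - averaging_matrix)"

lemma centering_entry: "(mat 1 - averaging_matrix :: real ^ 'p ^ 'p) $ i $ j
    = (if i = j then 1 else 0) - 1 / real CARD('p)"
  by (simp add: mat_def averaging_matrix_def)

lemma centering_colsum: "(\<Sum>i\<in>UNIV. (mat 1 - averaging_matrix :: real ^ 'p ^ 'p) $ i $ j) = 0"
  by (simp add: centering_entry sum_subtractf del: vector_minus_component)

text \<open>
  The function may be real (for second moments) or complex (for eigenvectors), hence the coercion by
  \<open>of_real\<close>.
\<close>

lemma centering_apply:
  fixes f :: "'p::finite \<Rightarrow> 'a::real_normed_field"
  assumes "(\<Sum>j\<in>UNIV. f j) = 0"
  shows "(\<Sum>j\<in>UNIV. of_real ((mat 1 - averaging_matrix :: real ^ 'p ^ 'p) $ i $ j) * f j) = f i"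
proof -
  have "(\<Sum>j\<in>UNIV. of_real ((mat 1 - averaging_matrix :: real ^ 'p ^ 'p) $ i $ j) * f j)
      = (\<Sum>j\<in>UNIV. (if i = j then f j else 0)) - of_real (1 / real CARD('p)) * (\<Sum>j\<in>UNIV. f j)"
    unfolding centering_entry sum_distrib_left sum_subtractf[symmetric]
    by (intro sum.cong refl) (simp add: algebra_simps)
  then show ?thesis using assms by simp
qed

lemma pair_projection_fixes:
  fixes f :: "'p::finite \<times> 'p \<Rightarrow> 'a::real_normed_field"
  assumes "\<And>l. (\<Sum>k\<in>UNIV. f (k, l)) = 0" "\<And>k. (\<Sum>l\<in>UNIV. f (k, l)) = 0"
  shows "(\<Sum>s\<in>UNIV. of_real (pair_projection $ r $ s) * f s) = f r"
proof -
  obtain i j where r: "r = (i, j)" by (cases r)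
  let ?D = "mat 1 - averaging_matrix :: real ^ 'p ^ 'p"
  have "(\<Sum>s\<in>UNIV. of_real (pair_projection $ r $ s) * f s)
      = (\<Sum>k\<in>UNIV. of_real (?D $ i $ k) * (\<Sum>l\<in>UNIV. of_real (?D $ j $ l) * f (k, l)))"
    by (simp add: sum_UNIV_prod r kronecker_def sum_distrib_left mult.assoc del: vector_minus_component)
  also have "\<dots> = f r"
    by (simp only: centering_apply assms r)
  finally show ?thesis .
qed

lemma pair_projection_marginals:
  fixes f :: "'p::finite \<times> 'p \<Rightarrow> 'a::real_normed_field"
  defines "u \<equiv> \<lambda>r. (\<Sum>s\<in>UNIV. of_real (pair_projection $ r $ s) * f s)"
  shows "(\<Sum>k\<in>UNIV. u (k, l)) = 0" "(\<Sum>l\<in>UNIV. u (k, l)) = 0"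
proof -
  let ?D = "mat 1 - averaging_matrix :: real ^ 'p ^ 'p"
  have D0: "(\<Sum>i\<in>UNIV. of_real (?D $ i $ j)) = (0 :: 'a)" for j
    using arg_cong[OF centering_colsum[of j], of "of_real :: real \<Rightarrow> 'a"] by simp
  have "(\<Sum>k\<in>UNIV. u (k, l))
      = (\<Sum>s\<in>UNIV. (\<Sum>k\<in>UNIV. of_real (?D $ k $ fst s)) * of_real (?D $ l $ snd s) * f s)"
    unfolding u_def
    by (subst sum.swap) (simp add: kronecker_def sum_distrib_right del: vector_minus_component)
  then show "(\<Sum>k\<in>UNIV. u (k, l)) = 0" by (simp only: D0) simp
  have "(\<Sum>l\<in>UNIV. u (k, l))
      = (\<Sum>s\<in>UNIV. (\<Sum>l\<in>UNIV. of_real (?D $ l $ snd s)) * of_real (?D $ k $ fst s) * f s)"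
    unfolding u_def
    by (subst sum.swap)
      (simp add: kronecker_def sum_distrib_right sum_distrib_left mult_ac del: vector_minus_component)
  then show "(\<Sum>l\<in>UNIV. u (k, l)) = 0" by (simp only: D0) simp
qed

text \<open>
  The hypotheses on \<open>g\<close> say that summing out one coordinate of the image forgets that
  coordinate of the argument; therefore \<open>T\<close> maps functions with zero marginals to
  functions with zero marginals. As the range of the projection consists of such functions,
  eigenvectors for nonzero eigenvalues have zero marginals and are not changed by the projection.
\<close>

lemma spec_radius_projected_less_1:
  fixes T :: "real ^ ('p::finite \<times> 'p) ^ ('p \<times> 'p)"
  assumes T: "column_stochastic T"
    and marg1: "\<And>j k l. (\<Sum>i\<in>UNIV. T $ (i, j) $ (k, l)) = g j l"
    and marg2: "\<And>i k l. (\<Sum>j\<in>UNIV. T $ (i, j) $ (k, l)) = g i k"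
    and pos: "\<And>r s. matrix_pow T m $ r $ s > 0"
  shows "spec_radius (T ** pair_projection) < 1"
proof -
  have "cmod c < 1" if eig: "c \<in> complex_eigenvalues (T ** pair_projection)" for c
  proof (cases "c = 0")
    case False
    from eig obtain v where v: "v \<noteq> 0"
      and ev: "map_matrix complex_of_real (T ** pair_projection) *v v = c *s v"
      by (auto simp: complex_eigenvalues_def)
    define u where "u r = (\<Sum>s\<in>UNIV. complex_of_real (pair_projection $ r $ s) * v $ s)" for r
    have u0: "(\<Sum>k\<in>UNIV. u (k, l)) = 0" "(\<Sum>l\<in>UNIV. u (k, l)) = 0" for k l
      unfolding u_def by (rule pair_projection_marginals)+
    have cv: "c * v $ r = (\<Sum>s\<in>UNIV. complex_of_real (T $ r $ s) * u s)" for r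
    proof -
      have "c * v $ r = (\<Sum>t\<in>UNIV. (\<Sum>s\<in>UNIV. complex_of_real (T $ r $ s) *
          complex_of_real (pair_projection $ s $ t)) * v $ t)"
        using arg_cong[OF ev, of "\<lambda>u. u $ r"]
        by (simp add: matrix_vector_mult_def matrix_matrix_mult_def)
      also have "\<dots> = (\<Sum>s\<in>UNIV. complex_of_real (T $ r $ s) * u s)"
        unfolding u_def sum_distrib_left sum_distrib_right mult.assoc by (rule sum.swap)
      finally show ?thesis .
    qed
    have "c * (\<Sum>i\<in>UNIV. v $ (i, j)) = 0" for j
    proof -
      have "c * (\<Sum>i\<in>UNIV. v $ (i, j))
          = (\<Sum>k\<in>UNIV. \<Sum>l\<in>UNIV. complex_of_real (\<Sum>i\<in>UNIV. T $ (i, j) $ (k, l)) * u (k, l))"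
        by (subst sum_distrib_left, subst cv, subst sum.swap)
          (simp add: sum_UNIV_prod sum_distrib_right)
      also have "\<dots> = (\<Sum>l\<in>UNIV. complex_of_real (g j l) * (\<Sum>k\<in>UNIV. u (k, l)))"
        unfolding marg1 sum_distrib_left by (rule sum.swap)
      finally show ?thesis by (simp add: u0)
    qed
    moreover have "c * (\<Sum>j\<in>UNIV. v $ (i, j)) = 0" for i
    proof -
      have "c * (\<Sum>j\<in>UNIV. v $ (i, j))
          = (\<Sum>k\<in>UNIV. \<Sum>l\<in>UNIV. complex_of_real (\<Sum>j\<in>UNIV. T $ (i, j) $ (k, l)) * u (k, l))"
        by (subst sum_distrib_left, subst cv, subst sum.swap)
          (simp add: sum_UNIV_prod sum_distrib_right)
      also have "\<dots> = (\<Sum>k\<in>UNIV. complex_of_real (g i k) * (\<Sum>l\<in>UNIV. u (k, l)))"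
        unfolding marg2 sum_distrib_left ..
      finally show ?thesis by (simp add: u0)
    qed
    ultimately have v0: "(\<Sum>i\<in>UNIV. v $ (i, j)) = 0" "(\<Sum>j\<in>UNIV. v $ (i, j)) = 0" for i j
      using False by auto
    have "u r = v $ r" for r
      unfolding u_def by (rule pair_projection_fixes) (rule v0)+
    then have "map_matrix complex_of_real T *v v = c *s v"
      using cv by (simp add: vec_eq_iff matrix_vector_mult_def)
    then have "map_matrix complex_of_real (matrix_pow T m) *v v = c ^ m *s v"
      by (rule matrix_pow_eigenvector)
    moreover have "(\<Sum>r\<in>UNIV. v $ r) = 0"
      by (simp add: sum_UNIV_prod v0)
    ultimately have "cmod (c ^ m) < 1"
      using positive_stochastic_contracts[of "matrix_pow T m" v] column_stochastic_pow[OF T] pos v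
      by blast
    then show ?thesis
      by (metis norm_power not_less one_le_power)
  qed simp
  then show ?thesis using spec_radius_attained[of "T ** pair_projection"] by auto
qed

section \<open>The second moment of a random stochastic matrix\<close>

locale random_stochastic_matrix = prob_space M for M +
  fixes X :: "'a \<Rightarrow> real ^ 'p ^ 'p"
  assumes rv: "X \<in> borel_measurable M"
    and stochastic: "\<omega> \<in> space M \<Longrightarrow> column_stochastic (X \<omega>)"
begin

definition second_moment :: "real ^ ('p::finite \<times> 'p) ^ ('p \<times> 'p)" where
  "second_moment = (\<integral>\<omega>. kronecker (X \<omega>) (X \<omega>) \<partial>M)"

lemma entry_measurable [measurable]: "(\<lambda>\<omega>. X \<omega> $ i $ j) \<in> borel_measurable M"
  using rv by (rule measurable_compose) (intro borel_measurable_continuous_onI continuous_intros)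

lemma entry_le_1: "\<omega> \<in> space M \<Longrightarrow> 0 \<le> X \<omega> $ i $ j" "\<omega> \<in> space M \<Longrightarrow> X \<omega> $ i $ j \<le> 1"
  using column_stochastic_entry_le_1 stochastic by blast+

lemma entry_integrable: "integrable M (\<lambda>\<omega>. X \<omega> $ i $ j)"
  by (rule integrable_const_bound[where B = 1]) (auto intro!: AE_I2 simp: entry_le_1)

lemma entry_prod_integrable: "integrable M (\<lambda>\<omega>. X \<omega> $ i $ k * X \<omega> $ j $ l)"
  by (rule integrable_const_bound[where B = 1])
    (auto intro!: AE_I2 mult_le_one simp: entry_le_1 abs_mult)

lemma kronecker_integrable: "integrable M (\<lambda>\<omega>. kronecker (X \<omega>) (X \<omega>))"
proof (rule integrable_const_bound[where B = "real CARD('p \<times> 'p) * real CARD('p \<times> 'p)"])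
  show "AE \<omega> in M. norm (kronecker (X \<omega>) (X \<omega>)) \<le> real CARD('p \<times> 'p) * real CARD('p \<times> 'p)"
  proof (rule AE_I2)
    fix \<omega> assume \<omega>: "\<omega> \<in> space M"
    let ?K = "kronecker (X \<omega>) (X \<omega>)"
    have "norm (?K $ r) \<le> real CARD('p \<times> 'p)" for r
    proof -
      have "norm (?K $ r) \<le> (\<Sum>s\<in>UNIV. \<bar>?K $ r $ s\<bar>)" by (rule norm_le_l1_cart)
      also have "\<dots> \<le> (\<Sum>s\<in>(UNIV :: ('p \<times> 'p) set). 1)"
        by (rule sum_mono) (auto simp: kronecker_def abs_mult entry_le_1[OF \<omega>] intro!: mult_le_one)
      finally show ?thesis by simp
    qed
    then have "(\<Sum>r\<in>UNIV. norm (?K $ r)) \<le> (\<Sum>r\<in>(UNIV :: ('p \<times> 'p) set). real CARD('p \<times> 'p))"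
      by (intro sum_mono)
    moreover have "norm ?K \<le> (\<Sum>r\<in>UNIV. norm (?K $ r))"
      unfolding norm_vec_def by (rule L2_set_le_sum) simp
    ultimately show "norm ?K \<le> real CARD('p \<times> 'p) * real CARD('p \<times> 'p)" by simp
  qed
  have "continuous_on UNIV (\<lambda>B :: real ^ 'p ^ 'p. kronecker B B)"
    unfolding kronecker_def by (intro continuous_intros)
  then have "(\<lambda>B :: real ^ 'p ^ 'p. kronecker B B) \<in> borel_measurable borel"
    by (rule borel_measurable_continuous_onI)
  then show "(\<lambda>\<omega>. kronecker (X \<omega>) (X \<omega>)) \<in> borel_measurable M"
    using rv by (rule measurable_compose[rotated])
qed

lemma second_moment_entry:
  "second_moment $ (i, j) $ (k, l) = (\<integral>\<omega>. X \<omega> $ i $ k * X \<omega> $ j $ l \<partial>M)"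
proof -
  have bl: "bounded_linear (\<lambda>K :: real ^ ('p \<times> 'p) ^ ('p \<times> 'p). K $ (i, j) $ (k, l))"
    using bounded_linear_compose[OF bounded_linear_vec_nth bounded_linear_vec_nth] .
  show ?thesis
    unfolding second_moment_def using integral_bounded_linear[OF bl kronecker_integrable]
    by (simp add: kronecker_def)
qed

lemma second_moment_marginals:
  "(\<Sum>i\<in>UNIV. second_moment $ (i, j) $ (k, l)) = (\<integral>\<omega>. X \<omega> $ j $ l \<partial>M)"
  "(\<Sum>j\<in>UNIV. second_moment $ (i, j) $ (k, l)) = (\<integral>\<omega>. X \<omega> $ i $ k \<partial>M)"
proof -
  have s: "(\<Sum>i\<in>UNIV. X \<omega> $ i $ k) = 1" if "\<omega> \<in> space M" for \<omega> k
    using stochastic[OF that] by (simp add: column_stochastic_def)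
  have "(\<Sum>i\<in>UNIV. second_moment $ (i, j) $ (k, l)) = (\<integral>\<omega>. (\<Sum>i\<in>UNIV. X \<omega> $ i $ k * X \<omega> $ j $ l) \<partial>M)"
    by (simp add: second_moment_entry entry_prod_integrable)
  also have "\<dots> = (\<integral>\<omega>. X \<omega> $ j $ l \<partial>M)"
    by (rule Bochner_Integration.integral_cong) (auto simp: sum_distrib_right[symmetric] s)
  finally show "(\<Sum>i\<in>UNIV. second_moment $ (i, j) $ (k, l)) = (\<integral>\<omega>. X \<omega> $ j $ l \<partial>M)" .
  have "(\<Sum>j\<in>UNIV. second_moment $ (i, j) $ (k, l)) = (\<integral>\<omega>. (\<Sum>j\<in>UNIV. X \<omega> $ i $ k * X \<omega> $ j $ l) \<partial>M)"
    by (simp add: second_moment_entry entry_prod_integrable)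
  also have "\<dots> = (\<integral>\<omega>. X \<omega> $ i $ k \<partial>M)"
    by (rule Bochner_Integration.integral_cong) (auto simp: sum_distrib_left[symmetric] s)
  finally show "(\<Sum>j\<in>UNIV. second_moment $ (i, j) $ (k, l)) = (\<integral>\<omega>. X \<omega> $ i $ k \<partial>M)" .
qed

lemma second_moment_stochastic: "column_stochastic second_moment"
proof -
  have "second_moment $ r $ s \<ge> 0" for r s
    by (cases r; cases s) (auto simp: second_moment_entry entry_le_1 intro!: integral_nonneg_AE AE_I2)
  moreover have "(\<Sum>r\<in>UNIV. second_moment $ r $ s) = 1" for s
  proof -
    obtain k l where s: "s = (k, l)" by (cases s)
    have "(\<Sum>r\<in>UNIV. second_moment $ r $ s) = (\<integral>\<omega>. (\<Sum>i\<in>UNIV. X \<omega> $ i $ k) \<partial>M)"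
      by (simp add: sum_UNIV_prod s second_moment_marginals entry_integrable)
    also have "\<dots> = (\<integral>\<omega>. 1 \<partial>M)"
      using stochastic by (intro Bochner_Integration.integral_cong) (auto simp: column_stochastic_def)
    finally show ?thesis by (simp add: prob_space)
  qed
  ultimately show ?thesis by (simp add: column_stochastic_def nonneg_matrix_def)
qed

text \<open>
  The product of the two entries is nonnegative, and positive on an open neighbourhood of
  \<open>B\<close>, which has positive probability.
\<close>

lemma second_moment_support:
  assumes supp: "\<And>U. open U \<Longrightarrow> B \<in> U \<Longrightarrow> prob (X -` U \<inter> space M) > 0"
    and B: "B $ i $ k > 0" "B $ i' $ k' > 0"
  shows "second_moment $ (i, i') $ (k, k') > 0"
proof -
  let ?U = "{B. B $ i $ k > 0} \<inter> {B. B $ i' $ k' > 0} :: (real ^ 'p ^ 'p) set"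
  have "open ?U" by (intro open_Int open_Collect_less continuous_intros)
  then have U: "prob (X -` ?U \<inter> space M) > 0" by (rule supp) (use B in simp)
  have "(\<integral>\<omega>. X \<omega> $ i $ k * X \<omega> $ i' $ k' \<partial>M) \<noteq> 0"
  proof
    assume "(\<integral>\<omega>. X \<omega> $ i $ k * X \<omega> $ i' $ k' \<partial>M) = 0"
    then have "AE \<omega> in M. X \<omega> $ i $ k * X \<omega> $ i' $ k' = 0"
      by (subst (asm) integral_nonneg_eq_0_iff_AE)
        (auto intro!: AE_I2 entry_prod_integrable simp: entry_le_1)
    then have "AE \<omega> in M. \<not> \<omega> \<in> X -` ?U \<inter> space M" by eventually_elim auto
    moreover have "X -` ?U \<inter> space M \<in> events"
      using \<open>open ?U\<close> rv by (intro measurable_sets[of X M borel]) auto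
    ultimately have "prob (X -` ?U \<inter> space M) = 0"
      by (simp only: prob_eq_0)
    with U show False by simp
  qed
  moreover have "second_moment $ (i, i') $ (k, k') \<ge> 0"
    using column_stochastic_entry_le_1[OF second_moment_stochastic] by blast
  ultimately show ?thesis by (simp add: second_moment_entry)
qed

theorem spec_radius_second_moment_less_1:
  assumes prim: "primitive_set S" and nn: "\<And>B. B \<in> S \<Longrightarrow> nonneg_matrix B"
    and supp: "\<And>B U. B \<in> S \<Longrightarrow> open U \<Longrightarrow> B \<in> U \<Longrightarrow> prob (X -` U \<inter> space M) > 0"
  shows "spec_radius (second_moment ** pair_projection) < 1"
proof -
  from prim obtain As where As: "set As \<subseteq> S" "\<And>i j. foldr (**) As (mat 1) $ i $ j > 0"
    by (auto simp: primitive_set_def)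
  have "matrix_pow second_moment (length As) $ r $ s > 0" for r s
    by (cases r; cases s)
      (auto intro!: kronecker_power_positive[where S = S] second_moment_stochastic
        second_moment_support nn supp As(2) dest: subsetD[OF As(1)])
  then show ?thesis
    by (intro spec_radius_projected_less_1[OF second_moment_stochastic]) (rule second_moment_marginals)+
qed

end

section \<open>Orbits of products of stochastic matrices\<close>

lemma product_orbit_cong:
  "(\<And>k. k \<in> {1..n} \<Longrightarrow> F k = G k) \<Longrightarrow> product_orbit F v n = product_orbit G v n"
  by (induction n) auto

lemma product_orbit_add: "product_orbit F (u + v) n = product_orbit F u n + product_orbit F v n"
  by (induction n) (auto simp: matrix_vector_right_distrib)

lemma product_orbit_scale: "product_orbit F (c *s v) n = c *s product_orbit F v n"
  by (induction n) (auto simp: vector_scalar_commute)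

lemma column_stochastic_sum:
  assumes "column_stochastic A"
  shows "(\<Sum>i\<in>UNIV. (A *v v) $ i) = (\<Sum>j\<in>UNIV. v $ j)"
proof -
  have "(\<Sum>i\<in>UNIV. (A *v v) $ i) = (\<Sum>j\<in>UNIV. (\<Sum>i\<in>UNIV. A $ i $ j) * v $ j)"
    by (simp add: matrix_vector_mult_def sum_distrib_right) (rule sum.swap)
  then show ?thesis using assms by (simp add: column_stochastic_def)
qed

lemma product_orbit_sum:
  assumes "\<And>k. k \<ge> 1 \<Longrightarrow> column_stochastic (F k)"
  shows "(\<Sum>i\<in>UNIV. product_orbit F v n $ i) = (\<Sum>j\<in>UNIV. v $ j)"
  by (induction n) (auto simp: column_stochastic_sum assms)

lemma product_orbit_abs_sum_le:
  assumes "\<And>k. k \<ge> 1 \<Longrightarrow> column_stochastic (F k)"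
  shows "(\<Sum>i\<in>UNIV. \<bar>product_orbit F v n $ i\<bar>) \<le> (\<Sum>j\<in>UNIV. \<bar>v $ j\<bar>)"
proof (induction n)
  case (Suc n)
  let ?y = "product_orbit F v n" and ?A = "F (Suc n)"
  have st: "column_stochastic ?A" by (rule assms) simp
  have "\<bar>(?A *v ?y) $ i\<bar> \<le> (?A *v (\<chi> j. \<bar>?y $ j\<bar>)) $ i" for i
    unfolding matrix_vector_mult_def
    by (simp, rule order_trans[OF sum_abs])
      (simp add: abs_mult column_stochastic_entry_le_1[OF st])
  then have "(\<Sum>i\<in>UNIV. \<bar>(?A *v ?y) $ i\<bar>) \<le> (\<Sum>i\<in>UNIV. (?A *v (\<chi> j. \<bar>?y $ j\<bar>)) $ i)"
    by (rule sum_mono)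
  also have "\<dots> = (\<Sum>j\<in>UNIV. \<bar>?y $ j\<bar>)" by (simp add: column_stochastic_sum[OF st])
  finally show ?case using Suc.IH by simp
qed simp

lemma measurable_matrix_vector_mult:
  fixes f :: "'a \<Rightarrow> real ^ 'n ^ 'm"
  assumes "f \<in> borel_measurable M" "g \<in> borel_measurable M"
  shows "(\<lambda>x. f x *v g x) \<in> borel_measurable M"
  using assms
  by (rule borel_measurable_continuous_Pair) (unfold matrix_vector_mult_def, intro continuous_intros)

lemma measurable_vec_nth:
  fixes f :: "'a \<Rightarrow> real ^ 'n"
  assumes "f \<in> borel_measurable M"
  shows "(\<lambda>x. f x $ i) \<in> borel_measurable M"
  using assms by (rule measurable_compose) (intro borel_measurable_continuous_onI continuous_intros)

text \<open>
  The first \<open>n\<close> steps of the orbit are a measurable function of the block of matrices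
  with indices in \<open>{1..N}\<close>; this is what makes them independent of later matrices.
\<close>

lemma product_orbit_measurable_PiM:
  fixes v :: "real ^ 'n"
  assumes "n \<le> N"
  shows "(\<lambda>F. product_orbit F v n) \<in> borel_measurable (PiM {1..N} (\<lambda>_. borel))"
  using assms
proof (induction n)
  case (Suc n)
  have "(\<lambda>F. F (Suc n)) \<in> measurable (PiM {1..N} (\<lambda>_. borel)) (borel :: (real ^ 'n ^ 'n) measure)"
    by (rule measurable_component_singleton) (use Suc.prems in simp)
  then show ?case
    using Suc by (simp add: measurable_matrix_vector_mult)
qed simp

section \<open>Mean-square decay of centered orbits\<close>

locale iid_sequence = prob_space M for M +
  fixes N :: "'b measure" and A :: "nat \<Rightarrow> 'a \<Rightarrow> 'b"
  assumes indep: "indep_vars (\<lambda>_. N) A {1..}"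
    and ident: "n \<ge> 1 \<Longrightarrow> distr M N (A n) = distr M N (A 1)"
begin

lemma A_measurable: "n \<ge> 1 \<Longrightarrow> A n \<in> measurable M N"
  using indep by (auto simp: indep_vars_def)

lemma prob_ident:
  assumes "n \<ge> 1" "U \<in> sets N"
  shows "prob (A n -` U \<inter> space M) = prob (A 1 -` U \<inter> space M)"
  using measure_distr[OF A_measurable[OF assms(1)] assms(2)] measure_distr[OF A_measurable[of 1] assms(2)]
  by (simp add: ident[OF assms(1)])

end

locale iid_stochastic_matrices = iid_sequence M "borel :: (real ^ 'p ^ 'p) measure" A
  for M :: "'a measure" and A :: "nat \<Rightarrow> 'a \<Rightarrow> real ^ 'p ^ 'p" +
  assumes stoch: "n \<ge> 1 \<Longrightarrow> \<omega> \<in> space M \<Longrightarrow> column_stochastic (A n \<omega>)"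
begin

sublocale random_stochastic_matrix M "A 1"
  by unfold_locales (auto intro: A_measurable stoch)

abbreviation orbit :: "real ^ 'p \<Rightarrow> nat \<Rightarrow> 'a \<Rightarrow> real ^ 'p" where
  "orbit v n \<omega> \<equiv> product_orbit (\<lambda>k. A k \<omega>) v n"

lemma orbit_measurable: "(\<lambda>\<omega>. orbit v n \<omega>) \<in> borel_measurable M"
  by (induction n) (auto intro!: measurable_matrix_vector_mult A_measurable)

lemma orbit_entry_measurable [measurable]: "(\<lambda>\<omega>. orbit v n \<omega> $ i) \<in> borel_measurable M"
  by (rule measurable_vec_nth[OF orbit_measurable])

lemma expectation_entry_prod:
  assumes "n \<ge> 1"
  shows "integrable M (\<lambda>\<omega>. A n \<omega> $ i $ k * A n \<omega> $ j $ l)"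
    and "(\<integral>\<omega>. A n \<omega> $ i $ k * A n \<omega> $ j $ l \<partial>M) = second_moment $ (i, j) $ (k, l)"
proof -
  have g: "(\<lambda>B :: real ^ 'p ^ 'p. B $ i $ k * B $ j $ l) \<in> borel_measurable borel"
    by (intro borel_measurable_continuous_onI continuous_intros)
  have D: "distr M borel (A n) = distr M borel (A 1)" by (rule ident) fact
  have "integrable (distr M borel (A 1)) (\<lambda>B. B $ i $ k * B $ j $ l)"
    using entry_prod_integrable by (simp add: integrable_distr_eq[OF A_measurable g])
  then show "integrable M (\<lambda>\<omega>. A n \<omega> $ i $ k * A n \<omega> $ j $ l)"
    unfolding D[symmetric] by (simp add: integrable_distr_eq[OF A_measurable[OF assms] g])
  show "(\<integral>\<omega>. A n \<omega> $ i $ k * A n \<omega> $ j $ l \<partial>M) = second_moment $ (i, j) $ (k, l)"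
    using integral_distr[OF A_measurable[OF assms] g] integral_distr[OF A_measurable[of 1] g]
    by (simp add: D second_moment_entry del: One_nat_def)
qed

lemma orbit_prod_integrable: "integrable M (\<lambda>\<omega>. orbit v n \<omega> $ i * orbit v n \<omega> $ j)"
proof (rule integrable_const_bound[where B = "(\<Sum>j\<in>UNIV. \<bar>v $ j\<bar>) * (\<Sum>j\<in>UNIV. \<bar>v $ j\<bar>)"])
  have *: "\<bar>orbit v n \<omega> $ i\<bar> \<le> (\<Sum>j\<in>UNIV. \<bar>v $ j\<bar>)" if "\<omega> \<in> space M" for \<omega> i
  proof -
    have "\<bar>orbit v n \<omega> $ i\<bar> \<le> (\<Sum>j\<in>UNIV. \<bar>orbit v n \<omega> $ j\<bar>)"
      by (rule member_le_sum) auto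
    also have "\<dots> \<le> (\<Sum>j\<in>UNIV. \<bar>v $ j\<bar>)"
      by (rule product_orbit_abs_sum_le) (use stoch that in auto)
    finally show ?thesis .
  qed
  show "AE \<omega> in M. norm (orbit v n \<omega> $ i * orbit v n \<omega> $ j)
      \<le> (\<Sum>j\<in>UNIV. \<bar>v $ j\<bar>) * (\<Sum>j\<in>UNIV. \<bar>v $ j\<bar>)"
    by (rule AE_I2) (auto simp: abs_mult intro!: mult_mono * sum_nonneg)
qed measurable

lemma indep_next_matrix_orbit:
  "indep_var borel (\<lambda>\<omega>. A (Suc n) \<omega> $ i $ k * A (Suc n) \<omega> $ j $ l)
             borel (\<lambda>\<omega>. orbit v n \<omega> $ k * orbit v n \<omega> $ l)"
proof -
  have ind: "indep_var (PiM {Suc n} (\<lambda>_. borel)) (\<lambda>\<omega>. restrict (\<lambda>i. A i \<omega>) {Suc n})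
      (PiM {1..n} (\<lambda>_. borel)) (\<lambda>\<omega>. restrict (\<lambda>i. A i \<omega>) {1..n})"
    by (rule indep_var_restrict[OF indep]) auto
  define Y where "Y F = F (Suc n) $ i $ k * F (Suc n) $ j $ l" for F :: "nat \<Rightarrow> real ^ 'p ^ 'p"
  define Z where "Z F = product_orbit F v n $ k * product_orbit F v n $ l" for F :: "nat \<Rightarrow> real ^ 'p ^ 'p"
  have Y: "Y \<in> borel_measurable (PiM {Suc n} (\<lambda>_. borel))"
  proof -
    have "(\<lambda>B :: real ^ 'p ^ 'p. B $ i $ k * B $ j $ l) \<in> borel_measurable borel"
      by (intro borel_measurable_continuous_onI continuous_intros)
    then show ?thesis
      unfolding Y_def
      by (intro measurable_compose[OF measurable_component_singleton]) auto
  qed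
  have Z: "Z \<in> borel_measurable (PiM {1..n} (\<lambda>_. borel))"
    unfolding Z_def
    by (intro borel_measurable_times measurable_vec_nth product_orbit_measurable_PiM order_refl)
  have "indep_var borel (Y \<circ> (\<lambda>\<omega>. restrict (\<lambda>i. A i \<omega>) {Suc n}))
      borel (Z \<circ> (\<lambda>\<omega>. restrict (\<lambda>i. A i \<omega>) {1..n}))"
    by (rule indep_var_compose[OF ind Y Z])
  also have "Y \<circ> (\<lambda>\<omega>. restrict (\<lambda>i. A i \<omega>) {Suc n}) = (\<lambda>\<omega>. A (Suc n) \<omega> $ i $ k * A (Suc n) \<omega> $ j $ l)"
    by (simp add: fun_eq_iff Y_def)
  also have "Z \<circ> (\<lambda>\<omega>. restrict (\<lambda>i. A i \<omega>) {1..n}) = (\<lambda>\<omega>. orbit v n \<omega> $ k * orbit v n \<omega> $ l)"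
  proof (rule ext)
    fix \<omega>
    have "product_orbit (restrict (\<lambda>i. A i \<omega>) {1..n}) v n = orbit v n \<omega>"
      by (rule product_orbit_cong) simp
    then show "(Z \<circ> (\<lambda>\<omega>. restrict (\<lambda>i. A i \<omega>) {1..n})) \<omega> = orbit v n \<omega> $ k * orbit v n \<omega> $ l"
      by (simp add: Z_def)
  qed
  finally show ?thesis .
qed

lemma orbit_second_moment_Suc:
  "(\<integral>\<omega>. orbit v (Suc n) \<omega> $ i * orbit v (Suc n) \<omega> $ j \<partial>M)
     = (\<Sum>k\<in>UNIV. \<Sum>l\<in>UNIV. second_moment $ (i, j) $ (k, l) * (\<integral>\<omega>. orbit v n \<omega> $ k * orbit v n \<omega> $ l \<partial>M))"
proof -
  let ?a = "\<lambda>k l \<omega>. A (Suc n) \<omega> $ i $ k * A (Suc n) \<omega> $ j $ l"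
  let ?y = "\<lambda>k l \<omega>. orbit v n \<omega> $ k * orbit v n \<omega> $ l"
  have int: "integrable M (\<lambda>\<omega>. ?a k l \<omega> * ?y k l \<omega>)" for k l
    by (rule indep_var_integrable[OF indep_next_matrix_orbit])
      (simp_all add: expectation_entry_prod orbit_prod_integrable)
  have eq: "(\<integral>\<omega>. ?a k l \<omega> * ?y k l \<omega> \<partial>M)
      = second_moment $ (i, j) $ (k, l) * (\<integral>\<omega>. ?y k l \<omega> \<partial>M)" for k l
    by (subst indep_var_lebesgue_integral[OF indep_next_matrix_orbit])
      (simp_all add: expectation_entry_prod orbit_prod_integrable)
  have "(\<integral>\<omega>. orbit v (Suc n) \<omega> $ i * orbit v (Suc n) \<omega> $ j \<partial>M)
      = (\<integral>\<omega>. (\<Sum>k\<in>UNIV. \<Sum>l\<in>UNIV. ?a k l \<omega> * ?y k l \<omega>) \<partial>M)"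
    by (simp add: matrix_vector_mult_def sum_product mult_ac)
  also have "\<dots> = (\<Sum>k\<in>UNIV. \<Sum>l\<in>UNIV. second_moment $ (i, j) $ (k, l) * (\<integral>\<omega>. ?y k l \<omega> \<partial>M))"
    by (simp only: Bochner_Integration.integral_sum Bochner_Integration.integrable_sum int eq)
  finally show ?thesis .
qed

text \<open>
  The second moments of a centered orbit have zero marginals, so inserting the projection before
  each application of the second moment matrix changes nothing.
\<close>

lemma orbit_second_moment:
  assumes v: "(\<Sum>i\<in>UNIV. v $ i) = 0"
  shows "(\<integral>\<omega>. orbit v n \<omega> $ i * orbit v n \<omega> $ j \<partial>M)
      = (((*v) (second_moment ** pair_projection)) ^^ n) (\<chi> r. v $ fst r * v $ snd r) $ (i, j)"
proof (induction n arbitrary: i j)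
  case 0
  show ?case by (simp add: prob_space)
next
  case (Suc n)
  let ?f = "\<lambda>s. \<integral>\<omega>. orbit v n \<omega> $ fst s * orbit v n \<omega> $ snd s \<partial>M"
  let ?V = "(((*v) (second_moment ** pair_projection)) ^^ n) (\<chi> r. v $ fst r * v $ snd r)"
  have V: "?V $ s = ?f s" for s
    using Suc.IH[of "fst s" "snd s"] by simp
  have sum0: "(\<Sum>i\<in>UNIV. orbit v n \<omega> $ i) = 0" if "\<omega> \<in> space M" for \<omega>
    using that v by (subst product_orbit_sum) (auto intro: stoch)
  have f1: "(\<Sum>k\<in>UNIV. ?f (k, l)) = 0" for l
  proof -
    have "(\<Sum>k\<in>UNIV. ?f (k, l)) = (\<integral>\<omega>. (\<Sum>k\<in>UNIV. orbit v n \<omega> $ k * orbit v n \<omega> $ l) \<partial>M)"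
      by (simp add: orbit_prod_integrable)
    also have "\<dots> = (\<integral>\<omega>. 0 \<partial>M)"
      by (rule Bochner_Integration.integral_cong) (auto simp: sum_distrib_right[symmetric] sum0)
    finally show ?thesis by simp
  qed
  have f2: "(\<Sum>l\<in>UNIV. ?f (k, l)) = 0" for k
    using f1[of k] by (simp add: mult.commute)
  have P: "(pair_projection *v ?V) $ s = ?f s" for s
    using pair_projection_fixes[of ?f s, OF f1 f2]
    by (simp add: matrix_vector_mult_def V del: One_nat_def)
  have "(((*v) (second_moment ** pair_projection)) ^^ Suc n) (\<chi> r. v $ fst r * v $ snd r) $ (i, j)
      = (second_moment *v (pair_projection *v ?V)) $ (i, j)"
    by (simp add: matrix_vector_mul_assoc)
  also have "\<dots> = (\<Sum>s\<in>UNIV. second_moment $ (i, j) $ s * ?f s)"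
    by (subst matrix_vector_mult_def) (simp add: P del: One_nat_def)
  also have "\<dots> = (\<integral>\<omega>. orbit v (Suc n) \<omega> $ i * orbit v (Suc n) \<omega> $ j \<partial>M)"
    by (simp only: orbit_second_moment_Suc sum_UNIV_prod fst_conv snd_conv)
  finally show ?case ..
qed

text \<open>
  Strictness in the assumption leaves room for a geometric ratio \<open>r / exp \<theta> < 1\<close>
  in Markov's inequality, so that the Borel-Cantelli lemma applies to each coordinate.
\<close>

theorem orbit_decay:
  assumes v: "(\<Sum>i\<in>UNIV. v $ i) = 0"
    and \<theta>: "spec_radius (second_moment ** pair_projection) < exp \<theta>"
  shows "AE \<omega> in M. eventually (\<lambda>n. (\<Sum>i\<in>UNIV. \<bar>orbit v n \<omega> $ i\<bar>) \<le> real CARD('p) * exp (real n * \<theta> / 2)) sequentially"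
proof -
  obtain r where r: "spec_radius (second_moment ** pair_projection) < r" "r < exp \<theta>"
    using dense[OF \<theta>] by blast
  have r0: "0 < r" using r(1) spec_radius_nonneg[of "second_moment ** pair_projection"] by linarith
  obtain C where C: "\<And>n i. \<bar>(((*v) (second_moment ** pair_projection)) ^^ n) (\<chi> r. v $ fst r * v $ snd r) $ i\<bar> \<le> C * r ^ n"
    using real_matrix_iterates_growth[OF r(1), of "\<chi> r. v $ fst r * v $ snd r"] by blast
  have "AE \<omega> in M. eventually (\<lambda>n. \<bar>orbit v n \<omega> $ i\<bar> \<le> exp (real n * \<theta> / 2)) sequentially" for i
  proof -
    let ?B = "\<lambda>n. {\<omega> \<in> space M. exp \<theta> ^ n \<le> orbit v n \<omega> $ i * orbit v n \<omega> $ i}"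
    have le: "prob (?B n) \<le> C * (r / exp \<theta>) ^ n" for n
    proof -
      have "prob (?B n) \<le> (\<integral>\<omega>. orbit v n \<omega> $ i * orbit v n \<omega> $ i \<partial>M) / exp \<theta> ^ n"
        by (rule integral_Markov_inequality_measure[where A = "{}"]) (auto intro: orbit_prod_integrable)
      also have "\<dots> \<le> C * r ^ n / exp \<theta> ^ n"
        using C[of n "(i, i)"] orbit_second_moment[OF v, of n i i] by (intro divide_right_mono) auto
      finally show ?thesis by (simp add: power_divide)
    qed
    have "summable (\<lambda>n. C * (r / exp \<theta>) ^ n)"
      using r r0 by (intro summable_mult summable_geometric) auto
    then have "summable (\<lambda>n. prob (?B n))"
      by (rule summable_comparison_test_ev[rotated]) (use le in \<open>auto intro!: always_eventually\<close>)
    then have "AE \<omega> in M. eventually (\<lambda>n. \<omega> \<in> space M - ?B n) sequentially"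
      by (intro borel_cantelli_AE1) (auto simp: less_top[symmetric])
    then show ?thesis
    proof eventually_elim
      case (elim \<omega>)
      then show ?case
      proof eventually_elim
        case (elim n)
        then have "(orbit v n \<omega> $ i)\<^sup>2 \<le> exp \<theta> ^ n"
          by (auto simp: power2_eq_square)
        also have "\<dots> = (exp (real n * \<theta> / 2))\<^sup>2"
          by (simp add: exp_of_nat_mult[symmetric] power2_eq_square exp_add[symmetric])
        finally show ?case by (simp add: abs_le_square_iff[symmetric])
      qed
    qed
  qed
  then have "AE \<omega> in M. \<forall>i. eventually (\<lambda>n. \<bar>orbit v n \<omega> $ i\<bar> \<le> exp (real n * \<theta> / 2)) sequentially"
    by (simp add: AE_all_countable)
  then show ?thesis
  proof eventually_elim
    case (elim \<omega>)
    then have "eventually (\<lambda>n. \<forall>i. \<bar>orbit v n \<omega> $ i\<bar> \<le> exp (real n * \<theta> / 2)) sequentially"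
      by (simp add: eventually_all_finite)
    then show ?case
    proof eventually_elim
      case (elim n)
      have "(\<Sum>i\<in>UNIV. \<bar>orbit v n \<omega> $ i\<bar>) \<le> (\<Sum>i\<in>(UNIV :: 'p set). exp (real n * \<theta> / 2))"
        by (rule sum_mono) (use elim in simp)
      then show ?case by simp
    qed
  qed
qed

end

section \<open>Waiting for a window\<close>

text \<open>
  The number of positive multiples of \<open>t\<close> below \<open>X\<close> is at most
  \<open>X / t\<close>; take expectations.
\<close>

lemma (in prob_space) sum_tail_prob_le:
  fixes X :: "'a \<Rightarrow> real"
  assumes X: "integrable M X" "\<And>\<omega>. \<omega> \<in> space M \<Longrightarrow> 0 \<le> X \<omega>" and t: "0 < t"
  shows "(\<Sum>n<N. prob {\<omega> \<in> space M. t * real (Suc n) < X \<omega>}) \<le> expectation X / t"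
proof -
  have [measurable]: "X \<in> borel_measurable M" using X(1) by auto
  let ?E = "\<lambda>n. {\<omega> \<in> space M. t * real (Suc n) < X \<omega>}"
  have int: "integrable M (\<lambda>\<omega>. indicator (?E n) \<omega> :: real)" for n by (intro integrable_real_indicator) (auto simp: less_top[symmetric])
  have "(\<Sum>n<N. prob (?E n)) = (\<integral>\<omega>. (\<Sum>n<N. indicator (?E n) \<omega>) \<partial>M)"
    by (subst Bochner_Integration.integral_sum[OF int]) simp
  also have "\<dots> \<le> (\<integral>\<omega>. X \<omega> / t \<partial>M)"
  proof (rule integral_mono)
    show "integrable M (\<lambda>\<omega>. \<Sum>n<N. indicator (?E n) \<omega> :: real)" by (rule Bochner_Integration.integrable_sum[OF int])
    show "integrable M (\<lambda>\<omega>. X \<omega> / t)" using X(1) by simp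
    fix \<omega> assume \<omega>: "\<omega> \<in> space M"
    have y: "X \<omega> / t \<ge> 0" using X(2)[OF \<omega>] t by simp
    have "(\<Sum>n<N. indicator (?E n) \<omega> :: real) = real (card {n\<in>{..<N}. t * real (Suc n) < X \<omega>})"
      using \<omega> by (simp add: indicator_def sum.If_cases Int_def)
    also have "{n\<in>{..<N}. t * real (Suc n) < X \<omega>} \<subseteq> {..<nat \<lfloor>X \<omega> / t\<rfloor>}"
    proof safe
      fix n assume "t * real (Suc n) < X \<omega>"
      then have "real (Suc n) < X \<omega> / t" using t by (simp add: field_simps)
      then have "int (Suc n) \<le> \<lfloor>X \<omega> / t\<rfloor>" by (simp add: le_floor_iff)
      then show "n < nat \<lfloor>X \<omega> / t\<rfloor>" by linarith
    qed
    then have "real (card {n\<in>{..<N}. t * real (Suc n) < X \<omega>}) \<le> real (nat \<lfloor>X \<omega> / t\<rfloor>)"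
      using card_mono[OF finite_lessThan] by (metis card_lessThan of_nat_le_iff)
    also have "\<dots> \<le> X \<omega> / t" using y by (simp add: of_nat_nat)
    finally show "(\<Sum>n<N. indicator (?E n) \<omega>) \<le> X \<omega> / t" .
  qed
  also have "\<dots> = expectation X / t" by simp
  finally show ?thesis .
qed

text \<open>
  A window of length \<open>k\<close> prescribes neighbourhoods for \<open>k\<close> consecutive
  terms of the sequence, listed backwards in time: \<open>U 0\<close> is for the most recent term.
  This matches products of matrices, in which the latest factor stands on the left.
\<close>

locale iid_windows = iid_sequence M N A for M N and A :: "nat \<Rightarrow> 'a \<Rightarrow> 'b" +
  fixes k :: nat and U :: "nat \<Rightarrow> 'b set"
  assumes k: "k \<ge> 1" and U_sets: "\<And>l. l < k \<Longrightarrow> U l \<in> sets N"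
    and U_pos: "\<And>l. l < k \<Longrightarrow> prob (A 1 -` U l \<inter> space M) > 0"
begin

definition window :: "nat \<Rightarrow> 'a \<Rightarrow> bool" where
  "window m \<omega> \<longleftrightarrow> k \<le> m \<and> (\<forall>l<k. A (m - l) \<omega> \<in> U l)"

definition window_prob :: real where "window_prob = (\<Prod>l<k. prob (A 1 -` U l \<inter> space M))"

lemma window_prob_bounds: "0 < window_prob" "window_prob \<le> 1"
  unfolding window_prob_def using U_pos by (auto intro!: prod_pos prod_le_1)

lemma window_measurable [measurable]: "Measurable.pred M (window m)"
proof (cases "k \<le> m")
  case True
  have "Measurable.pred M (\<lambda>\<omega>. \<forall>l\<in>{..<k}. A (m - l) \<omega> \<in> U l)"
  proof (rule pred_intros_finite)
    fix l assume "l \<in> {..<k}"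
    then show "Measurable.pred M (\<lambda>\<omega>. A (m - l) \<omega> \<in> U l)"
      using True by (intro pred_sets2[OF U_sets A_measurable]) auto
  qed simp
  moreover have "window m = (\<lambda>\<omega>. \<forall>l\<in>{..<k}. A (m - l) \<omega> \<in> U l)"
    using True by (auto simp: window_def fun_eq_iff)
  ultimately show ?thesis by (simp only:)
next
  case False
  then have "window m = (\<lambda>\<omega>. False)" by (auto simp: window_def fun_eq_iff)
  then show ?thesis by (simp only: measurable_const space_count_space UNIV_I)
qed

lemma prob_window:
  assumes m: "k \<le> m"
  shows "prob {\<omega> \<in> space M. window m \<omega>} = window_prob"
proof -
  let ?J = "{m - k<..m}"
  have "{\<omega> \<in> space M. window m \<omega>} = (\<Inter>i\<in>?J. A i -` U (m - i) \<inter> space M)"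
  proof (intro set_eqI iffI)
    fix \<omega> assume "\<omega> \<in> {\<omega> \<in> space M. window m \<omega>}"
    then have w: "\<omega> \<in> space M" "\<And>l. l < k \<Longrightarrow> A (m - l) \<omega> \<in> U l" by (auto simp: window_def)
    have "A i \<omega> \<in> U (m - i)" if "i \<in> ?J" for i
    proof -
      have "m - i < k" "m - (m - i) = i" using that m by auto
      then show ?thesis using w(2)[of "m - i"] by simp
    qed
    with w(1) show "\<omega> \<in> (\<Inter>i\<in>?J. A i -` U (m - i) \<inter> space M)" by blast
  next
    fix \<omega> assume \<omega>: "\<omega> \<in> (\<Inter>i\<in>?J. A i -` U (m - i) \<inter> space M)"
    have "A (m - l) \<omega> \<in> U l" if "l < k" for l
    proof -
      have l: "m - l \<in> ?J" "m - (m - l) = l" using that m by auto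
      from \<omega> l(1) have "\<omega> \<in> A (m - l) -` U (m - (m - l))" by blast
      then show ?thesis by (simp only: l(2) vimage_eq)
    qed
    moreover have "m \<in> ?J" using k m by auto
    then have "\<omega> \<in> space M" using \<omega> by blast
    ultimately show "\<omega> \<in> {\<omega> \<in> space M. window m \<omega>}" using m by (auto simp: window_def)
  qed
  also have "prob \<dots> = (\<Prod>i\<in>?J. prob (A i -` U (m - i) \<inter> space M))"
    by (rule indep_varsD[OF indep]) (use k m in \<open>auto intro!: U_sets\<close>)
  also have "\<dots> = (\<Prod>i\<in>?J. prob (A 1 -` U (m - i) \<inter> space M))"
    by (intro prod.cong refl prob_ident U_sets) (use m k in auto)
  also have "\<dots> = window_prob"
    unfolding window_prob_def
  proof (rule prod.reindex_bij_witness[of _ "\<lambda>l. m - l" "\<lambda>i. m - i"])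
    fix i assume "i \<in> ?J"
    then show "m - (m - i) = i" "m - i \<in> {..<k}" using m by auto
  next
    fix l assume "l \<in> {..<k}"
    then show "m - (m - l) = l" "m - l \<in> ?J" using m by auto
  qed (rule refl)
  finally show ?thesis .
qed

text \<open>
  Inside the \<open>n - i\<close> steps after time \<open>i\<close> there is room for
  \<open>(n - i) div k\<close> disjoint windows. They are independent of each other and of the term
  at time \<open>i\<close>, and each fails with probability \<open>1 - window_prob\<close>.
\<close>

lemma prob_large_then_no_window:
  fixes H :: "'b \<Rightarrow> real"
  assumes H [measurable]: "H \<in> borel_measurable N" and i: "1 \<le> i" "i \<le> n"
  shows "prob {\<omega> \<in> space M. t < H (A i \<omega>) \<and> (\<forall>m\<in>{i + k..n}. \<not> window m \<omega>)}
    \<le> prob {\<omega> \<in> space M. t < H (A 1 \<omega>)} * (1 - window_prob) ^ ((n - i) div k)"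
proof -
  define d where "d = (n - i) div k"
  have dk: "d * k \<le> n - i" unfolding d_def by simp
  have bk: "Suc b * k \<le> n - i" if "b < d" for b
    using that dk by (meson Suc_leI le_trans mult_le_mono1)
  \<comment> \<open>block \<open>0\<close> is the time \<open>i\<close> itself; block \<open>b + 1\<close> is the \<open>b\<close>-th window, counted backwards from \<open>n\<close>\<close>
  define K where "K j = (case j of 0 \<Rightarrow> {i} | Suc b \<Rightarrow> {n - Suc b * k<..n - b * k})" for j
  define E where "E j = {F \<in> space (PiM (K j) (\<lambda>_. N)).
    case j of 0 \<Rightarrow> t < H (F i) | Suc b \<Rightarrow> \<not> (\<forall>l\<in>{..<k}. F (n - b * k - l) \<in> U l)}" for j
  let ?R = "\<lambda>j \<omega>. restrict (\<lambda>i. A i \<omega>) (K j)"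
  have Kpos: "K j \<subseteq> {1..}" if "j \<le> d" for j
    using that i by (auto simp: K_def split: nat.splits)
  have inK: "n - b * k - l \<in> K (Suc b)" if "b < d" "l < k" for b l
    using bk[OF that(1)] that(2) i by (auto simp: K_def)
  have disj: "K j \<inter> K j' = {}" if jj: "j < j'" "j' \<le> d" for j j'
  proof (cases j)
    case 0
    then obtain b where "j' = Suc b" "b < d" using jj by (cases j') auto
    then show ?thesis using bk[of b] i 0 by (auto simp: K_def)
  next
    case (Suc b)
    then obtain b' where b': "j' = Suc b'" "b < b'" using jj by (cases j') auto
    then have "Suc b * k \<le> b' * k" by (intro mult_le_mono1) simp
    then have "n - b' * k \<le> n - Suc b * k" by (rule diff_le_mono2)
    then show ?thesis using Suc b' by (auto simp: K_def)
  qed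
  have fam: "disjoint_family_on K {..d}"
    unfolding disjoint_family_on_def
  proof (intro ballI impI)
    fix j j' assume jj: "j \<in> {..d}" "j' \<in> {..d}" "j \<noteq> j'"
    then show "K j \<inter> K j' = {}" using disj[of j j'] disj[of j' j] by (cases "j < j'") auto
  qed
  have ind: "indep_vars (\<lambda>j. PiM (K j) (\<lambda>_. N)) ?R {..d}"
    by (rule indep_vars_restrict[OF indep]) (use Kpos fam in auto)
  have Esets: "E j \<in> sets (PiM (K j) (\<lambda>_. N))" if "j \<le> d" for j
  proof (cases j)
    case 0
    have "(\<lambda>F. F i) \<in> measurable (PiM (K 0) (\<lambda>_. N)) N"
      by (rule measurable_component_singleton) (simp add: K_def)
    then have "(\<lambda>F. H (F i)) \<in> borel_measurable (PiM (K 0) (\<lambda>_. N))"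
      using H by (rule measurable_compose)
    then show ?thesis unfolding E_def 0 nat.case by (simp only: borel_measurable_iff_greater)
  next
    case (Suc b)
    have "Measurable.pred (PiM (K (Suc b)) (\<lambda>_. N)) (\<lambda>F. \<forall>l\<in>{..<k}. F (n - b * k - l) \<in> U l)"
    proof (rule pred_intros_finite)
      fix l assume l: "l \<in> {..<k}"
      have "(\<lambda>F. F (n - b * k - l)) \<in> measurable (PiM (K (Suc b)) (\<lambda>_. N)) N"
        by (rule measurable_component_singleton) (use that Suc l inK[of b l] in auto)
      then show "Measurable.pred (PiM (K (Suc b)) (\<lambda>_. N)) (\<lambda>F. F (n - b * k - l) \<in> U l)"
        using l by (intro pred_sets2[OF U_sets]) auto
    qed simp
    then have "{F \<in> space (PiM (K (Suc b)) (\<lambda>_. N)). \<not> (\<forall>l\<in>{..<k}. F (n - b * k - l) \<in> U l)}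
        \<in> sets (PiM (K (Suc b)) (\<lambda>_. N))"
      unfolding pred_def by (rule sets.sets_Collect_neg)
    then show ?thesis unfolding E_def Suc nat.case .
  qed
  have Rsp: "?R j \<omega> \<in> space (PiM (K j) (\<lambda>_. N))" if "j \<le> d" "\<omega> \<in> space M" for j \<omega>
    using Kpos[OF that(1)] measurable_space[OF A_measurable that(2)]
    by (auto simp: space_PiM PiE_iff)
  have pre0: "?R 0 -` E 0 \<inter> space M = {\<omega> \<in> space M. t < H (A i \<omega>)}"
    using Rsp[of 0] by (auto simp: E_def K_def)
  have preS: "?R (Suc b) -` E (Suc b) \<inter> space M = {\<omega> \<in> space M. \<not> window (n - b * k) \<omega>}" if b: "b < d" for b
  proof -
    have "k \<le> n - b * k" using bk[OF b] i by simp
    moreover have "(\<forall>l\<in>{..<k}. ?R (Suc b) \<omega> (n - b * k - l) \<in> U l) \<longleftrightarrow> (\<forall>l<k. A (n - b * k - l) \<omega> \<in> U l)" for \<omega>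
      using inK[OF b] by auto
    ultimately show ?thesis
      using Rsp[of "Suc b"] b by (auto simp: E_def window_def simp del: restrict_apply)
  qed
  have pS: "prob {\<omega> \<in> space M. \<not> window (n - b * k) \<omega>} = 1 - window_prob" if b: "b < d" for b
    using bk[OF b] i by (subst prob_neg) (auto simp: prob_window)
  have p0: "prob {\<omega> \<in> space M. t < H (A i \<omega>)} = prob {\<omega> \<in> space M. t < H (A 1 \<omega>)}"
  proof -
    have S: "{b \<in> space N. t < H b} \<in> sets N" by measurable
    have "A j -` {b \<in> space N. t < H b} \<inter> space M = {\<omega> \<in> space M. t < H (A j \<omega>)}" if "j \<ge> 1" for j
      using measurable_space[OF A_measurable[OF that]] by auto
    then show ?thesis using prob_ident[OF i(1) S] i(1) by simp
  qed
  have "prob {\<omega> \<in> space M. t < H (A i \<omega>) \<and> (\<forall>m\<in>{i + k..n}. \<not> window m \<omega>)}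
      \<le> prob (\<Inter>j\<in>{..d}. ?R j -` E j \<inter> space M)"
  proof (rule finite_measure_mono)
    show "{\<omega> \<in> space M. t < H (A i \<omega>) \<and> (\<forall>m\<in>{i + k..n}. \<not> window m \<omega>)}
        \<subseteq> (\<Inter>j\<in>{..d}. ?R j -` E j \<inter> space M)"
    proof (intro INT_greatest)
      fix j assume j: "j \<in> {..d}"
      show "{\<omega> \<in> space M. t < H (A i \<omega>) \<and> (\<forall>m\<in>{i + k..n}. \<not> window m \<omega>)} \<subseteq> ?R j -` E j \<inter> space M"
      proof (cases j)
        case 0
        then show ?thesis using pre0 by auto
      next
        case (Suc b)
        with j have b: "b < d" by simp
        then have "n - b * k \<in> {i + k..n}" using bk[OF b] i by auto
        then show ?thesis using preS[OF b] Suc by auto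
      qed
    qed
    show "(\<Inter>j\<in>{..d}. ?R j -` E j \<inter> space M) \<in> events"
      using ind Esets by (intro sets.finite_INT) (auto simp: indep_vars_def intro!: measurable_sets)
  qed
  also have "\<dots> = (\<Prod>j\<in>{..d}. prob (?R j -` E j \<inter> space M))"
    by (rule indep_varsD_finite[OF ind]) (use Esets in auto)
  also have "\<dots> = prob (?R 0 -` E 0 \<inter> space M) * (\<Prod>b<d. prob (?R (Suc b) -` E (Suc b) \<inter> space M))"
    by (simp only: prod.atMost_shift)
  also have "\<dots> = prob {\<omega> \<in> space M. t < H (A 1 \<omega>)} * (1 - window_prob) ^ d"
    by (simp add: pre0 preS pS p0 del: prod_constant) (simp add: pS)
  finally show ?thesis unfolding d_def .
qed

text \<open>
  A term at time \<open>i\<close> counts only as long as no window has both started after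
  \<open>i\<close> and ended by \<open>n\<close>; a window ending at \<open>m\<close> starts at
  \<open>m - k + 1\<close>, which explains the bound \<open>i + k\<close>.
\<close>

definition gap_sum :: "('b \<Rightarrow> real) \<Rightarrow> nat \<Rightarrow> 'a \<Rightarrow> real" where
  "gap_sum H n \<omega> = (\<Sum>i\<in>{1..n}. if \<exists>m\<in>{i + k..n}. window m \<omega> then 0 else H (A i \<omega>))"

text \<open>
  Split the allowance \<open>\<epsilon> n\<close> geometrically: the term \<open>j\<close> steps in
  the past gets \<open>\<delta>\<^sub>j n\<close> with \<open>\<delta>\<^sub>j\<close> proportional
  to \<open>r^j\<close>. If the gap sum exceeds \<open>\<epsilon> n\<close>, some term exceeds its
  share while no window has occurred since, an event of probability at most
  \<open>P(H(A\<^sub>1) > \<delta>\<^sub>j n)\<close> times a multiple of \<open>\<gamma>^j\<close>.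
  Summing first over \<open>n\<close> gives \<open>E H(A\<^sub>1) / \<delta>\<^sub>j\<close>, and
  the remaining sum over \<open>j\<close> converges because \<open>\<gamma> < r\<close>.
\<close>

theorem gap_sum_sublinear:
  assumes H [measurable]: "H \<in> borel_measurable N" and H0: "\<And>b. 0 \<le> H b"
    and int: "integrable M (\<lambda>\<omega>. H (A 1 \<omega>))" and \<epsilon>: "0 < \<epsilon>"
  shows "AE \<omega> in M. eventually (\<lambda>n. gap_sum H n \<omega> \<le> \<epsilon> * real n) sequentially"
proof -
  \<comment> \<open>Bernoulli gives \<open>\<gamma>^k \<ge> 1 - window_prob / 2\<close>; the factor \<open>2\<close> keeps \<open>\<gamma>\<close> positive even when \<open>window_prob = k = 1\<close>\<close>
  define \<gamma> where "\<gamma> = 1 - window_prob / (2 * real k)"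
  have qk: "0 < window_prob / (2 * real k)" "window_prob / (2 * real k) < 1"
    using window_prob_bounds k by (auto simp: field_simps)
  then have \<gamma>: "0 < \<gamma>" "\<gamma> < 1" by (auto simp: \<gamma>_def)
  have "1 - window_prob \<le> 1 + real k * (- (window_prob / (2 * real k)))" using window_prob_bounds k by simp
  also have "\<dots> \<le> \<gamma> ^ k"
    unfolding \<gamma>_def using Bernoulli_inequality[of "- (window_prob / (2 * real k))" k] qk by simp
  finally have fail_le: "1 - window_prob \<le> \<gamma> ^ k" .
  \<comment> \<open>any ratio strictly between \<open>\<gamma>\<close> and \<open>1\<close> would do; with the square root, \<open>\<gamma> / r = r\<close>\<close>
  define r where "r = sqrt \<gamma>"
  have r: "0 < r" "r < 1" and r2: "\<gamma> = r * r" using \<gamma> by (auto simp: r_def)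
  define \<delta> where "\<delta> j = \<epsilon> * (1 - r) * r ^ j" for j
  have \<delta>: "0 < \<delta> j" for j using \<epsilon> r by (simp add: \<delta>_def)
  let ?e = "\<lambda>j n. prob {\<omega> \<in> space M. \<delta> j * real n < H (A 1 \<omega>)}"
  let ?B = "\<lambda>n. {\<omega> \<in> space M. \<epsilon> * real n < gap_sum H n \<omega>}"
  let ?C = "\<lambda>i n. {\<omega> \<in> space M. \<delta> (n - i) * real n < H (A i \<omega>) \<and> (\<forall>m\<in>{i + k..n}. \<not> window m \<omega>)}"
  have HA [measurable]: "(\<lambda>\<omega>. H (A i \<omega>)) \<in> borel_measurable M" if "1 \<le> i" for i
    using A_measurable[OF that] H by (rule measurable_compose)
  have [measurable]: "(\<lambda>\<omega>. gap_sum H n \<omega>) \<in> borel_measurable M" for n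
    unfolding gap_sum_def by (intro borel_measurable_sum measurable_If HA) auto
  have Cm: "?C i n \<in> events" if "1 \<le> i" for i n
    using HA[OF that] by measurable
  have subset: "?B n \<subseteq> (\<Union>i\<in>{1..n}. ?C i n)" for n
  proof (rule ccontr)
    assume "\<not> ?thesis"
    then obtain \<omega> where \<omega>: "\<omega> \<in> space M" "\<epsilon> * real n < gap_sum H n \<omega>" "\<And>i. i \<in> {1..n} \<Longrightarrow> \<omega> \<notin> ?C i n"
      by blast
    have "gap_sum H n \<omega> \<le> (\<Sum>i\<in>{1..n}. \<delta> (n - i) * real n)"
      unfolding gap_sum_def using \<omega>(1,3) \<delta> by (intro sum_mono) (force simp: not_less less_imp_le)
    also have "\<dots> = (\<Sum>j<n. \<delta> j * real n)"
      by (rule sum.reindex_bij_witness[of _ "\<lambda>j. n - j" "\<lambda>i. n - i"]) auto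
    also have "\<dots> = \<epsilon> * real n * ((1 - r) * (\<Sum>j<n. r ^ j))"
      unfolding \<delta>_def by (simp add: sum_distrib_left mult_ac)
    also have "(1 - r) * (\<Sum>j<n. r ^ j) = 1 - r ^ n" by (rule one_diff_power_eq[symmetric])
    also have "\<epsilon> * real n * (1 - r ^ n) \<le> \<epsilon> * real n * 1"
      using \<epsilon> r by (intro mult_left_mono) auto
    finally show False using \<omega>(2) by simp
  qed
  have decay: "(1 - window_prob) ^ (j div k) \<le> \<gamma> ^ j / \<gamma> ^ k" for j
  proof -
    have "(1 - window_prob) ^ (j div k) \<le> (\<gamma> ^ k) ^ (j div k)" using fail_le window_prob_bounds by (intro power_mono) auto
    then have "(1 - window_prob) ^ (j div k) * \<gamma> ^ k \<le> \<gamma> ^ (k * (j div k)) * \<gamma> ^ k"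
      using \<gamma> by (intro mult_right_mono) (auto simp: power_mult)
    also have "\<dots> = \<gamma> ^ (k * (j div k) + k)" by (simp add: power_add)
    also have "j \<le> k * (j div k) + k"
      using k by (metis add_le_cancel_left mod_less_divisor mult_div_mod_eq less_imp_le_nat zero_less_one less_le_trans)
    then have "\<gamma> ^ (k * (j div k) + k) \<le> \<gamma> ^ j" using \<gamma> by (intro power_decreasing) auto
    finally show ?thesis using \<gamma> by (simp add: pos_le_divide_eq)
  qed
  have PB: "prob (?B n) \<le> (\<Sum>j<n. ?e j n * (\<gamma> ^ j / \<gamma> ^ k))" for n
  proof -
    have "prob (?B n) \<le> prob (\<Union>i\<in>{1..n}. ?C i n)"
      using subset Cm by (intro finite_measure_mono sets.finite_UN) auto
    also have "\<dots> \<le> (\<Sum>i\<in>{1..n}. prob (?C i n))"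
      using Cm by (intro finite_measure_subadditive_finite) auto
    also have "\<dots> \<le> (\<Sum>i\<in>{1..n}. ?e (n - i) n * (\<gamma> ^ (n - i) / \<gamma> ^ k))"
    proof (rule sum_mono)
      fix i assume i: "i \<in> {1..n}"
      have "prob (?C i n) \<le> ?e (n - i) n * (1 - window_prob) ^ ((n - i) div k)"
        by (rule prob_large_then_no_window[OF H]) (use i in auto)
      also have "\<dots> \<le> ?e (n - i) n * (\<gamma> ^ (n - i) / \<gamma> ^ k)"
        by (intro mult_left_mono decay) simp
      finally show "prob (?C i n) \<le> ?e (n - i) n * (\<gamma> ^ (n - i) / \<gamma> ^ k)" .
    qed
    also have "\<dots> = (\<Sum>j<n. ?e j n * (\<gamma> ^ j / \<gamma> ^ k))"
      by (rule sum.reindex_bij_witness[of _ "\<lambda>j. n - j" "\<lambda>i. n - i"]) auto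
    finally show ?thesis .
  qed
  define \<mu> where "\<mu> = expectation (\<lambda>\<omega>. H (A 1 \<omega>))"
  have \<mu>: "0 \<le> \<mu>" unfolding \<mu>_def by (rule integral_nonneg_AE) (simp add: H0)
  define c where "c = \<mu> / (\<epsilon> * (1 - r) * \<gamma> ^ k)"
  have c: "0 \<le> c" unfolding c_def using \<mu> \<epsilon> r \<gamma> by simp
  have "(\<Sum>n<L. prob (?B (Suc n))) \<le> c / (1 - r)" for L
  proof -
    have "(\<Sum>n<L. prob (?B (Suc n))) \<le> (\<Sum>n<L. \<Sum>j<L. ?e j (Suc n) * (\<gamma> ^ j / \<gamma> ^ k))"
    proof (rule sum_mono)
      fix n assume "n \<in> {..<L}"
      then have "(\<Sum>j<Suc n. ?e j (Suc n) * (\<gamma> ^ j / \<gamma> ^ k)) \<le> (\<Sum>j<L. ?e j (Suc n) * (\<gamma> ^ j / \<gamma> ^ k))"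
        using \<gamma> by (intro sum_mono2) auto
      then show "prob (?B (Suc n)) \<le> (\<Sum>j<L. ?e j (Suc n) * (\<gamma> ^ j / \<gamma> ^ k))"
        using PB[of "Suc n"] by linarith
    qed
    also have "\<dots> = (\<Sum>j<L. (\<Sum>n<L. ?e j (Suc n)) * (\<gamma> ^ j / \<gamma> ^ k))"
      by (subst sum.swap) (simp only: sum_distrib_right)
    also have "\<dots> \<le> (\<Sum>j<L. \<mu> / \<delta> j * (\<gamma> ^ j / \<gamma> ^ k))"
      unfolding \<mu>_def using \<gamma> int H0 \<delta>
      by (intro sum_mono mult_right_mono sum_tail_prob_le) auto
    also have "\<dots> = c * (\<Sum>j<L. r ^ j)"
      unfolding sum_distrib_left c_def \<delta>_def
      using r \<epsilon> \<gamma> by (intro sum.cong refl) (simp add: r2 power_mult_distrib field_simps)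
    also have "\<dots> \<le> c * (1 / (1 - r))"
    proof (rule mult_left_mono[OF _ c])
      have "(1 - r) * (\<Sum>j<L. r ^ j) \<le> 1" using r by (simp add: one_diff_power_eq[symmetric])
      then show "(\<Sum>j<L. r ^ j) \<le> 1 / (1 - r)" using r by (simp add: field_simps)
    qed
    finally show ?thesis by simp
  qed
  then have "summable (\<lambda>n. prob (?B (Suc n)))"
    by (intro summableI_nonneg_bounded) auto
  then have "AE \<omega> in M. eventually (\<lambda>n. \<omega> \<in> space M - ?B (Suc n)) sequentially"
    by (intro borel_cantelli_AE1) (auto simp: less_top[symmetric])
  then show ?thesis
  proof eventually_elim
    case (elim \<omega>)
    then have "eventually (\<lambda>n. gap_sum H (Suc n) \<omega> \<le> \<epsilon> * real (Suc n)) sequentially"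
      by eventually_elim auto
    then show ?case by (rule eventually_sequentially_Suc[THEN iffD1])
  qed
qed

end

section \<open>The weights decay subexponentially\<close>

text \<open>
  On column-stochastic matrices this is \<open>- ln (min_nonzero_entry B)\<close>. The detour makes
  it a nonnegative Borel function on all matrices: a minimum over a fixed index set is measurable,
  and zero entries are replaced by \<open>1\<close>, which no entry of a stochastic matrix exceeds.
\<close>

definition neg_log_min_entry :: "real ^ 'n ^ 'm \<Rightarrow> real" where
  "neg_log_min_entry B = max 0 (- ln (MIN p. if B $ fst p $ snd p \<noteq> 0 then B $ fst p $ snd p else 1))"

lemma min_nonzero_entry_bounds:
  fixes B :: "real ^ 'n ^ 'm"
  assumes B: "column_stochastic B"
  shows "0 < min_nonzero_entry B" "min_nonzero_entry B \<le> 1"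
    and "0 < B $ i $ j \<Longrightarrow> min_nonzero_entry B \<le> B $ i $ j"
    and "neg_log_min_entry B = - ln (min_nonzero_entry B)"
proof -
  let ?Z = "{B $ i $ j | i j. B $ i $ j \<noteq> 0}"
  let ?f = "\<lambda>p. if B $ fst p $ snd p \<noteq> 0 then B $ fst p $ snd p else 1"
  have "?Z \<subseteq> (\<lambda>(i, j). B $ i $ j) ` UNIV" by auto
  then have fin: "finite ?Z" by (rule finite_subset) simp
  have "\<exists>i. B $ i $ j \<noteq> 0" for j
  proof (rule ccontr)
    assume "\<nexists>i. B $ i $ j \<noteq> 0"
    then have "(\<Sum>i\<in>UNIV. B $ i $ j) = 0" by simp
    then show False using B by (simp add: column_stochastic_def)
  qed
  then have ne: "?Z \<noteq> {}" by blast
  have nn: "0 \<le> B $ i $ j" "B $ i $ j \<le> 1" for i j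
    using column_stochastic_entry_le_1[OF B] by blast+
  have "Min ?Z \<in> ?Z" using fin ne by (rule Min_in)
  then obtain i0 j0 where m: "Min ?Z = B $ i0 $ j0" "B $ i0 $ j0 \<noteq> 0" by auto
  then show pos: "0 < min_nonzero_entry B" and le1: "min_nonzero_entry B \<le> 1"
    using nn[of i0 j0] by (auto simp: min_nonzero_entry_def)
  have min: "min_nonzero_entry B \<le> B $ i $ j" if "0 < B $ i $ j" for i j
  proof -
    have "B $ i $ j \<noteq> 0" using that by simp
    then have "B $ i $ j \<in> ?Z" by blast
    then show ?thesis unfolding min_nonzero_entry_def by (rule Min_le[OF fin])
  qed
  then show "0 < B $ i $ j \<Longrightarrow> min_nonzero_entry B \<le> B $ i $ j" .
  have "(MIN p. ?f p) = min_nonzero_entry B"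
  proof (rule Min_eqI)
    show "min_nonzero_entry B \<le> y" if "y \<in> range ?f" for y
      using that min le1 nn by (auto simp: order_le_less)
    show "min_nonzero_entry B \<in> range ?f"
      using m by (intro image_eqI[of _ _ "(i0, j0)"]) (auto simp: min_nonzero_entry_def)
  qed simp
  then show "neg_log_min_entry B = - ln (min_nonzero_entry B)"
    using pos le1 by (simp add: neg_log_min_entry_def)
qed

lemma exp_neg_log_min_entry_le:
  assumes "column_stochastic B" "0 < B $ i $ j"
  shows "exp (- neg_log_min_entry B) \<le> B $ i $ j"
  using min_nonzero_entry_bounds[OF assms(1)] assms(2) by simp

lemma neg_log_min_entry_measurable: "neg_log_min_entry \<in> borel_measurable (borel :: (real ^ 'n ^ 'm) measure)"
proof -
  have [measurable]: "(\<lambda>B :: real ^ 'n ^ 'm. B $ i $ j) \<in> borel_measurable borel" for i j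
    by (intro borel_measurable_continuous_onI continuous_intros)
  have "(\<lambda>B :: real ^ 'n ^ 'm. MIN p. if B $ fst p $ snd p \<noteq> 0 then B $ fst p $ snd p else 1) \<in> borel_measurable borel"
    by (rule borel_measurable_Min) auto
  then show ?thesis
    unfolding neg_log_min_entry_def[abs_def] by measurable
qed

lemma product_orbit_nonneg:
  assumes "\<And>k. k \<ge> 1 \<Longrightarrow> nonneg_matrix (F k)" "\<And>i. 0 \<le> v $ i"
  shows "0 \<le> product_orbit F v n $ i"
  by (induction n arbitrary: i)
    (use assms in \<open>auto simp: matrix_vector_mult_def nonneg_matrix_def intro!: sum_nonneg\<close>)

lemma matrix_vector_mult_mono:
  fixes B C :: "real ^ 'n ^ 'm"
  assumes "\<And>i j. B $ i $ j \<le> C $ i $ j" "\<And>j. u $ j \<le> v $ j" "nonneg_matrix C" "\<And>j. 0 \<le> u $ j"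
  shows "(B *v u) $ i \<le> (C *v v) $ i"
  using assms by (auto simp: matrix_vector_mult_def nonneg_matrix_def intro!: sum_mono mult_mono)

lemma nonneg_matrix_mat_1: "nonneg_matrix (mat 1 :: real ^ 'n ^ 'n)"
  by (simp add: nonneg_matrix_def mat_def)

lemma nonneg_matrix_mult:
  fixes B C :: "real ^ 'n ^ 'n"
  shows "nonneg_matrix B \<Longrightarrow> nonneg_matrix C \<Longrightarrow> nonneg_matrix (B ** C)"
  by (auto simp: nonneg_matrix_def matrix_matrix_mult_def intro!: sum_nonneg)

lemma nonneg_matrix_list_product:
  fixes As :: "(real ^ 'n ^ 'n) list"
  assumes "\<And>B. B \<in> set As \<Longrightarrow> nonneg_matrix B"
  shows "nonneg_matrix (foldr (**) As (mat 1))"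
  using assms
  by (induction As) (auto intro: nonneg_matrix_mult simp: nonneg_matrix_mat_1)

text \<open>
  If the last \<open>k\<close> matrices dominate half of the matrices in the list, the orbit
  dominates what the product of the list makes of the orbit \<open>k\<close> steps earlier, up to
  \<open>k\<close> factors \<open>1/2\<close>.
\<close>

lemma product_orbit_ge_list_product:
  fixes As :: "(real ^ 'n ^ 'n) list"
  assumes F: "\<And>k. k \<ge> 1 \<Longrightarrow> nonneg_matrix (F k)" and v: "\<And>i. 0 \<le> v $ i"
    and As: "\<And>B. B \<in> set As \<Longrightarrow> nonneg_matrix B"
    and m: "length As \<le> m"
    and le: "\<And>l i j. l < length As \<Longrightarrow> (As ! l) $ i $ j / 2 \<le> F (m - l) $ i $ j"
  shows "(1 / 2) ^ length As * (foldr (**) As (mat 1) *v product_orbit F v (m - length As)) $ i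
    \<le> product_orbit F v m $ i"
  using As m le
proof (induction As arbitrary: m i)
  case (Cons B As)
  obtain m' where m': "m = Suc m'" using Cons.prems(2) by (cases m) auto
  let ?P = "foldr (**) As (mat 1)" and ?w = "product_orbit F v (m - length (B # As))"
  let ?u = "(1 / 2) ^ length As *s (?P *v ?w)"
  have nonneg: "0 \<le> (?P *v ?w) $ i" for i
  proof -
    have "nonneg_matrix ?P" by (rule nonneg_matrix_list_product) (use Cons.prems(1) in simp)
    then show ?thesis
      using product_orbit_nonneg[of F v, OF F v]
      by (auto simp: nonneg_matrix_def matrix_vector_mult_def intro!: sum_nonneg)
  qed
  have IH: "?u $ i \<le> product_orbit F v m' $ i" for i
    using Cons.IH[of m' i] Cons.prems(1,2) Cons.prems(3)[of "Suc _"] by (simp add: m')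
  have B: "((1 / 2) *\<^sub>R B) $ i $ j \<le> F m $ i $ j" for i j
    using Cons.prems(3)[of 0 i j] by simp
  have "(((1 / 2) *\<^sub>R B) *v ?u) $ i \<le> (F m *v product_orbit F v m') $ i"
    by (rule matrix_vector_mult_mono) (use B IH F m' nonneg in auto)
  moreover have "(((1 / 2) *\<^sub>R B) *v ?u) $ i
      = (1 / 2) ^ length (B # As) * ((B ** ?P) *v ?w) $ i"
    by (simp add: vector_scalar_commute matrix_vector_mul_assoc[symmetric])
      (simp add: matrix_vector_mult_def sum_distrib_left mult_ac)
  ultimately show ?case by (simp add: m')
qed simp

context iid_windows
begin

lemma gap_sum_nonneg: "(\<And>b. 0 \<le> H b) \<Longrightarrow> 0 \<le> gap_sum H n \<omega>"
  unfolding gap_sum_def by (intro sum_nonneg) auto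

lemma gap_sum_Suc:
  assumes "\<not> window (Suc n) \<omega>"
  shows "gap_sum H (Suc n) \<omega> = gap_sum H n \<omega> + H (A (Suc n) \<omega>)"
proof -
  have "(\<exists>m\<in>{i + k..Suc n}. window m \<omega>) \<longleftrightarrow> (\<exists>m\<in>{i + k..n}. window m \<omega>)" for i
    using assms by (auto simp: le_Suc_eq) 
  moreover have "{Suc n + k..n} = {}" by simp
  ultimately show ?thesis
    unfolding gap_sum_def by (simp del: atLeastatMost_empty_iff2)
qed

text \<open>
  Between windows, each row of the next matrix has a nonzero entry, which is at least
  \<open>exp (- neg_log_min_entry)\<close>; so the lower bound loses exactly the term that the gap
  sum gains. A window restores the bound \<open>\<kappa>\<close>.
\<close>

lemma orbit_lower_bound:
  fixes F :: "nat \<Rightarrow> real ^ 'p ^ 'p" and H :: "'b \<Rightarrow> real"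
  assumes st: "\<And>n. n \<ge> 1 \<Longrightarrow> column_stochastic (F n)"
    and al: "\<And>n. n \<ge> 1 \<Longrightarrow> allowable (F n)"
    and \<kappa>: "0 < \<kappa>" "\<kappa> \<le> 1"
    and window: "\<And>m i. window m \<omega> \<Longrightarrow> \<kappa> \<le> product_orbit F (\<chi> i. 1) m $ i"
    and H0: "\<And>b. 0 \<le> H b" and H: "\<And>n. n \<ge> 1 \<Longrightarrow> H (A n \<omega>) = neg_log_min_entry (F n)"
  shows "\<kappa> * exp (- gap_sum H n \<omega>) \<le> product_orbit F (\<chi> i. 1) n $ i"
proof (induction n arbitrary: i)
  case 0
  show ?case using \<kappa> by (simp add: gap_sum_def)
next
  case (Suc n)
  let ?w = "product_orbit F (\<chi> i. 1)"
  show ?case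
  proof (cases "window (Suc n) \<omega>")
    case True
    have "\<kappa> * exp (- gap_sum H (Suc n) \<omega>) \<le> \<kappa> * 1"
      using gap_sum_nonneg[of H "Suc n" \<omega>] H0 \<kappa> by (intro mult_left_mono) auto
    then show ?thesis using window[OF True, of i] by linarith
  next
    case False
    obtain j where j: "0 < F (Suc n) $ i $ j" using al[of "Suc n"] by (auto simp: allowable_def)
    have "\<kappa> * exp (- gap_sum H (Suc n) \<omega>)
        = exp (- neg_log_min_entry (F (Suc n))) * (\<kappa> * exp (- gap_sum H n \<omega>))"
      using H[of "Suc n"] by (simp add: gap_sum_Suc[OF False] exp_add[symmetric])
    also have "\<dots> \<le> F (Suc n) $ i $ j * ?w n $ j"
      using exp_neg_log_min_entry_le[OF st j] Suc.IH[of j] \<kappa> j by (intro mult_mono) auto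
    also have "\<dots> \<le> (\<Sum>j\<in>UNIV. F (Suc n) $ i $ j * ?w n $ j)"
    proof (rule member_le_sum)
      fix j
      have "0 \<le> ?w n $ j"
        by (rule product_orbit_nonneg) (use st in \<open>auto simp: column_stochastic_def\<close>)
      then show "0 \<le> F (Suc n) $ i $ j * ?w n $ j"
        using column_stochastic_entry_le_1[OF st[of "Suc n"]] by simp
    qed auto
    finally show ?thesis by (simp add: matrix_vector_mult_def)
  qed
qed

end

text \<open>
  The windows come from a strictly positive product of members of \<open>S\<close>. A window forces
  the last matrices above half of its factors, and the positive product then distributes the
  conserved total weight \<open>p\<close> over all coordinates.
\<close>

theorem (in iid_stochastic_matrices) weights_subexponential:
  fixes S :: "(real ^ 'p ^ 'p) set"
  assumes S: "\<And>B. B \<in> S \<Longrightarrow> column_stochastic B" "\<And>B. B \<in> S \<Longrightarrow> allowable B"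
    and prim: "primitive_set S"
    and range: "\<And>n \<omega>. n \<ge> 1 \<Longrightarrow> \<omega> \<in> space M \<Longrightarrow> A n \<omega> \<in> S"
    and supp: "\<And>B U. B \<in> S \<Longrightarrow> open U \<Longrightarrow> B \<in> U \<Longrightarrow> prob (A 1 -` U \<inter> space M) > 0"
    and int: "integrable M (\<lambda>\<omega>. neg_log_min_entry (A 1 \<omega>))"
    and \<epsilon>: "0 < \<epsilon>"
  shows "\<exists>\<kappa>>0. AE \<omega> in M. eventually (\<lambda>n. \<forall>i. \<kappa> * exp (- (\<epsilon> * real n)) \<le> orbit (\<chi> i. 1) n \<omega> $ i) sequentially"
proof -
  from prim obtain As where As: "As \<noteq> []" "set As \<subseteq> S" and pos: "\<And>i j. foldr (**) As (mat 1) $ i $ j > 0"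
    by (auto simp: primitive_set_def)
  \<comment> \<open>open, and contains the \<open>l\<close>-th factor: only its positive entries are constrained, and strictly\<close>
  define U where "U l = (\<Inter>i. \<Inter>j. if (As ! l) $ i $ j > 0 then {B :: real ^ 'p ^ 'p. (As ! l) $ i $ j / 2 < B $ i $ j} else UNIV)" for l
  have U_open: "open (U l)" for l
    unfolding U_def by (intro open_INT ballI) (auto intro!: open_Collect_less continuous_intros)
  have U_in: "As ! l \<in> U l" for l by (auto simp: U_def)
  have nthS: "As ! l \<in> S" if "l < length As" for l using that As(2) by auto
  interpret iid_windows M borel A "length As" U
  proof unfold_locales
    show "1 \<le> length As" using As(1) by (cases As) auto
    show "U l \<in> sets borel" for l using U_open by (rule borel_open)
    show "0 < prob (A 1 -` U l \<inter> space M)" if "l < length As" for l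
      by (rule supp[OF nthS[OF that] U_open U_in])
  qed
  obtain d where d: "0 < d" "\<And>i j. d \<le> foldr (**) As (mat 1) $ i $ j"
    using positive_matrix_bounded_below[of "foldr (**) As (mat 1)"] pos by blast
  define \<kappa> where "\<kappa> = min 1 ((1 / 2) ^ length As * (d * real CARD('p)))"
  have \<kappa>: "0 < \<kappa>" "\<kappa> \<le> 1" using d(1) by (auto simp: \<kappa>_def)
  have win: "\<kappa> \<le> orbit (\<chi> i. 1) m \<omega> $ i" if \<omega>: "\<omega> \<in> space M" and w: "window m \<omega>" for m \<omega> i
  proof -
    let ?P = "foldr (**) As (mat 1)" and ?u = "orbit (\<chi> i. 1) (m - length As) \<omega>"
    have m: "length As \<le> m" "\<And>l. l < length As \<Longrightarrow> A (m - l) \<omega> \<in> U l" using w by (auto simp: window_def)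
    have le: "(As ! l) $ i $ j / 2 \<le> A (m - l) \<omega> $ i $ j" if l: "l < length As" for l i j
    proof (cases "(As ! l) $ i $ j > 0")
      case True
      have "A (m - l) \<omega> \<in> (if (As ! l) $ i $ j > 0 then {B :: real ^ 'p ^ 'p. (As ! l) $ i $ j / 2 < B $ i $ j} else UNIV)"
        using m(2)[OF l] unfolding U_def by blast
      then show ?thesis using True by simp
    next
      case False
      have "0 \<le> A (m - l) \<omega> $ i $ j"
        using l m(1) by (intro column_stochastic_entry_le_1 stoch \<omega>) auto
      then show ?thesis using False by simp
    qed
    have nn: "0 \<le> ?u $ j" for j
      by (rule product_orbit_nonneg) (use stoch \<omega> in \<open>auto simp: column_stochastic_def\<close>)
    have "d * real CARD('p) = (\<Sum>j\<in>UNIV. d * ?u $ j)"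
      unfolding sum_distrib_left[symmetric] by (subst product_orbit_sum) (auto simp: stoch \<omega>)
    also have "\<dots> \<le> (?P *v ?u) $ i"
      using d(2) nn by (auto simp: matrix_vector_mult_def intro!: sum_mono mult_right_mono)
    finally have "(1 / 2) ^ length As * (d * real CARD('p)) \<le> (1 / 2) ^ length As * (?P *v ?u) $ i"
      by (intro mult_left_mono) auto
    also have "\<dots> \<le> orbit (\<chi> i. 1) m \<omega> $ i"
      by (rule product_orbit_ge_list_product)
        (use m(1) le As(2) S stoch \<omega> in \<open>auto simp: column_stochastic_def\<close>)
    finally show ?thesis by (simp add: \<kappa>_def)
  qed
  have H0: "0 \<le> neg_log_min_entry B" for B :: "real ^ 'p ^ 'p"
    by (simp add: neg_log_min_entry_def)
  have "AE \<omega> in M. eventually (\<lambda>n. gap_sum neg_log_min_entry n \<omega> \<le> \<epsilon> * real n) sequentially"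
    by (rule gap_sum_sublinear[OF neg_log_min_entry_measurable H0 int \<epsilon>])
  then have "AE \<omega> in M. eventually (\<lambda>n. \<forall>i. \<kappa> * exp (- (\<epsilon> * real n)) \<le> orbit (\<chi> i. 1) n \<omega> $ i) sequentially"
  proof (rule AE_mp, intro AE_I2 impI)
    fix \<omega> assume \<omega>: "\<omega> \<in> space M"
      and "eventually (\<lambda>n. gap_sum neg_log_min_entry n \<omega> \<le> \<epsilon> * real n) sequentially"
    from this(2) show "eventually (\<lambda>n. \<forall>i. \<kappa> * exp (- (\<epsilon> * real n)) \<le> orbit (\<chi> i. 1) n \<omega> $ i) sequentially"
    proof eventually_elim
      case (elim n)
      have "\<kappa> * exp (- (\<epsilon> * real n)) \<le> \<kappa> * exp (- gap_sum neg_log_min_entry n \<omega>)"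
        using elim \<kappa> by simp
      moreover have "\<kappa> * exp (- gap_sum neg_log_min_entry n \<omega>) \<le> orbit (\<chi> i. 1) n \<omega> $ i" for i
        by (rule orbit_lower_bound) (use \<omega> stoch S range win \<kappa> H0 in auto)
      ultimately show ?case using order_trans by blast
    qed
  qed
  with \<kappa>(1) show ?thesis by blast
qed

section \<open>Convergence rate of the ratios\<close>

theorem (in iid_stochastic_matrices) ratio_error_decay:
  fixes S :: "(real ^ 'p ^ 'p) set" and x0 :: "real ^ 'p"
  assumes S: "\<And>B. B \<in> S \<Longrightarrow> column_stochastic B" "\<And>B. B \<in> S \<Longrightarrow> allowable B"
    and prim: "primitive_set S"
    and range: "\<And>n \<omega>. n \<ge> 1 \<Longrightarrow> \<omega> \<in> space M \<Longrightarrow> A n \<omega> \<in> S"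
    and supp: "\<And>B U. B \<in> S \<Longrightarrow> open U \<Longrightarrow> B \<in> U \<Longrightarrow> prob (A 1 -` U \<inter> space M) > 0"
    and int: "integrable M (\<lambda>\<omega>. neg_log_min_entry (A 1 \<omega>))"
    and \<theta>: "spec_radius (second_moment ** pair_projection) < exp \<theta>" "\<theta> < \<theta>'"
    and xbar: "xbar = (1 / real CARD('p)) * (\<Sum>i\<in>UNIV. x0 $ i)"
  shows "AE \<omega> in M. eventually (\<lambda>n.
    (\<Sum>i\<in>UNIV. \<bar>orbit x0 n \<omega> $ i / orbit (\<chi> i. 1) n \<omega> $ i - xbar\<bar>) \<le> exp (real n * \<theta>' / 2)) sequentially"
proof -
  define y0 where "y0 = x0 - xbar *s (\<chi> i. 1)"
  have y0: "(\<Sum>i\<in>UNIV. y0 $ i) = 0" by (simp add: y0_def sum_subtractf xbar)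
  have x_eq: "orbit x0 n \<omega> = orbit y0 n \<omega> + xbar *s orbit (\<chi> i. 1) n \<omega>" for n \<omega>
    unfolding product_orbit_scale[symmetric] product_orbit_add[symmetric] by (simp add: y0_def)
  \<comment> \<open>half of the room \<open>(\<theta>' - \<theta>) / 2\<close> absorbs the decay of the weights, the other half the constant factor\<close>
  define \<epsilon> where "\<epsilon> = (\<theta>' - \<theta>) / 4"
  have \<epsilon>: "0 < \<epsilon>" using \<theta>(2) by (simp add: \<epsilon>_def)
  obtain \<kappa> where \<kappa>: "0 < \<kappa>" and w:
    "AE \<omega> in M. eventually (\<lambda>n. \<forall>i. \<kappa> * exp (- (\<epsilon> * real n)) \<le> orbit (\<chi> i. 1) n \<omega> $ i) sequentially"
  proof -
    have "\<exists>\<kappa>>0. AE \<omega> in M. eventually (\<lambda>n. \<forall>i. \<kappa> * exp (- (\<epsilon> * real n)) \<le> orbit (\<chi> i. 1) n \<omega> $ i) sequentially"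
      by (rule weights_subexponential[of S]; fact)
    then show ?thesis using that by blast
  qed
  have "filterlim (\<lambda>n. \<epsilon> * real n) at_top sequentially"
    using \<epsilon> by (intro filterlim_tendsto_pos_mult_at_top[OF tendsto_const] filterlim_real_sequentially)
  then have "eventually (\<lambda>n. ln (real CARD('p) / \<kappa>) \<le> \<epsilon> * real n) sequentially"
    by (simp add: filterlim_at_top)
  then have const: "eventually (\<lambda>n. real CARD('p) / \<kappa> \<le> exp (\<epsilon> * real n)) sequentially"
    by eventually_elim (metis \<kappa> divide_pos_pos exp_le_cancel_iff exp_ln of_nat_0_less_iff zero_less_card_finite)
  show ?thesis
    using w orbit_decay[OF y0 \<theta>(1)]
  proof eventually_elim
    case (elim \<omega>)
    from elim const show ?case
    proof eventually_elim
      case (elim n)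
      let ?w = "orbit (\<chi> i. 1) n \<omega>" and ?y = "orbit y0 n \<omega>"
      define l where "l = \<kappa> * exp (- (\<epsilon> * real n))"
      have l: "0 < l" "\<And>i. l \<le> ?w $ i" using \<kappa> elim by (auto simp: l_def)
      have inv: "inverse l = exp (\<epsilon> * real n) / \<kappa>"
        unfolding l_def exp_minus inverse_mult_distrib inverse_inverse_eq by (simp add: divide_inverse)
      have "(\<Sum>i\<in>UNIV. \<bar>orbit x0 n \<omega> $ i / ?w $ i - xbar\<bar>) \<le> (\<Sum>i\<in>UNIV. \<bar>?y $ i\<bar> / l)"
      proof (rule sum_mono)
        fix i
        have wi: "0 < ?w $ i" using l(1) l(2)[of i] by linarith
        have "orbit x0 n \<omega> $ i / ?w $ i - xbar = ?y $ i / ?w $ i"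
          using wi by (simp add: x_eq add_divide_distrib)
        then have "\<bar>orbit x0 n \<omega> $ i / ?w $ i - xbar\<bar> = \<bar>?y $ i\<bar> / ?w $ i" using wi by simp
        also have "\<dots> \<le> \<bar>?y $ i\<bar> / l" using l wi by (intro divide_left_mono) auto
        finally show "\<bar>orbit x0 n \<omega> $ i / ?w $ i - xbar\<bar> \<le> \<bar>?y $ i\<bar> / l" .
      qed
      also have "\<dots> = (\<Sum>i\<in>UNIV. \<bar>?y $ i\<bar>) / l" by (simp add: sum_divide_distrib)
      also have "\<dots> \<le> (real CARD('p) * exp (real n * \<theta> / 2)) / l"
        using elim l(1) by (intro divide_right_mono) auto
      also have "\<dots> = real CARD('p) / \<kappa> * exp (real n * \<theta> / 2 + \<epsilon> * real n)"
        unfolding divide_inverse[of _ l] inv exp_add by simp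
      also have "\<dots> \<le> exp (\<epsilon> * real n) * exp (real n * \<theta> / 2 + \<epsilon> * real n)"
        using elim by (intro mult_right_mono) auto
      also have "\<dots> = exp (real n * \<theta>' / 2)"
        by (simp add: exp_add[symmetric] \<epsilon>_def field_simps)
      finally show ?case .
    qed
  qed
qed

lemma ln_le_iff: "0 < (t :: real) \<Longrightarrow> ln t \<le> y \<longleftrightarrow> t \<le> exp y"
  by (metis exp_le_cancel_iff exp_ln)

text \<open>
  Where \<open>a n = 0\<close>, the rate is \<open>-\<infinity>\<close> and satisfies any bound.
\<close>

lemma limsup_log_rate_le:
  assumes "eventually (\<lambda>n. a n \<le> exp (real n * c)) sequentially"
  shows "limsup (\<lambda>n. ereal_log (a n) / ereal (real n)) \<le> ereal c"
proof (rule Limsup_bounded)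
  show "eventually (\<lambda>n. ereal_log (a n) / ereal (real n) \<le> ereal c) sequentially"
    using assms eventually_gt_at_top[of 0]
  proof eventually_elim
    case (elim n)
    show ?case
    proof (cases "a n > 0")
      case True
      then have "ln (a n) \<le> real n * c" using elim by (simp add: ln_le_iff)
      then show ?thesis using True elim by (simp add: ereal_log_def field_simps)
    qed (use elim in \<open>simp add: ereal_log_def\<close>)
  qed
qed

lemma ereal_log_less_iff:
  assumes "0 \<le> t"
  shows "ereal_log t < ereal \<theta> \<longleftrightarrow> t < exp \<theta>"
proof (cases "t = 0")
  case False
  then have "0 < t" using assms by simp
  then show ?thesis by (simp add: ereal_log_def) (metis exp_less_cancel_iff exp_ln)
qed (simp add: ereal_log_def)

theorem theorem1:
  fixes M :: "'w measure"
    and S :: "(real ^ 'p ^ 'p) set"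
    and A :: "nat \<Rightarrow> 'w \<Rightarrow> real ^ 'p ^ 'p"
    and x0 :: "real ^ 'p"
    and x w :: "nat \<Rightarrow> 'w \<Rightarrow> real ^ 'p"
    and xbar :: real
    and eta2 :: ereal
  assumes "prob_space M"
    and "S \<in> sets borel"
    and "\<forall>B\<in>S. nonneg_matrix B \<and> allowable B \<and> column_stochastic B"
    and "primitive_set S"
    and "prob_space.indep_vars M (\<lambda>_. borel) A {1..}"
    and "\<forall>n\<ge>1. distr M borel (A n) = distr M borel (A 1)"
    and "\<forall>n\<ge>1. \<forall>\<omega>\<in>space M. A n \<omega> \<in> S"
    and "fully_supported (distr M borel (A 1)) S"
    and "integrable M (\<lambda>\<omega>. log_minus (min_nonzero_entry (A 1 \<omega>)))"
    and "x = (\<lambda>n \<omega>. product_orbit (\<lambda>k. A k \<omega>) x0 n)"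
    and "w = (\<lambda>n \<omega>. product_orbit (\<lambda>k. A k \<omega>) (\<chi> i. 1) n)"
    and "xbar = (1 / real CARD('p)) * (\<Sum>i\<in>UNIV. x0 $ i)"
    and "eta2 = ereal_log (spec_radius
           ((\<integral>\<omega>. kronecker (A 1 \<omega>) (A 1 \<omega>) \<partial>M) **
            kronecker (mat 1 - averaging_matrix) (mat 1 - averaging_matrix)))"
  shows "(AE \<omega> in M.
            limsup (\<lambda>n. ereal_log (\<Sum>i\<in>UNIV. \<bar>x n \<omega> $ i / w n \<omega> $ i - xbar\<bar>) / ereal (real n))
              \<le> eta2 / 2)
         \<and> eta2 / 2 < 0"
proof -
  interpret prob_space M by fact
  interpret iid_stochastic_matrices M A
  proof unfold_locales
    show "indep_vars (\<lambda>_. borel) A {1..}" by fact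
    show "distr M borel (A n) = distr M borel (A 1)" if "1 \<le> n" for n
      using assms(6) that by blast
    show "column_stochastic (A n \<omega>)" if "1 \<le> n" "\<omega> \<in> space M" for n \<omega>
      using assms(3,7) that by blast
  qed
  have S: "\<And>B. B \<in> S \<Longrightarrow> column_stochastic B" "\<And>B. B \<in> S \<Longrightarrow> allowable B" "\<And>B. B \<in> S \<Longrightarrow> nonneg_matrix B"
    and range: "\<And>n \<omega>. n \<ge> 1 \<Longrightarrow> \<omega> \<in> space M \<Longrightarrow> A n \<omega> \<in> S"
    using assms(3,7) by blast+
  have supp: "prob (A 1 -` U \<inter> space M) > 0" if "B \<in> S" "open U" "B \<in> U" for B U
  proof -
    have "emeasure (distr M borel (A 1)) (U \<inter> S) > 0"
      using assms(8) that by (simp add: fully_supported_def)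
    also have "emeasure (distr M borel (A 1)) (U \<inter> S) \<le> emeasure (distr M borel (A 1)) U"
      using that(2) by (intro emeasure_mono) auto
    also have "\<dots> = emeasure M (A 1 -` U \<inter> space M)"
      using that(2) by (intro emeasure_distr A_measurable) auto
    finally show ?thesis by (simp add: emeasure_eq_measure)
  qed
  have "integrable M (\<lambda>\<omega>. - log_minus (min_nonzero_entry (A 1 \<omega>)))" using assms(9) by simp
  also have "?this \<longleftrightarrow> integrable M (\<lambda>\<omega>. neg_log_min_entry (A 1 \<omega>))"
  proof (rule Bochner_Integration.integrable_cong[OF refl])
    fix \<omega> assume "\<omega> \<in> space M"
    then have "column_stochastic (A 1 \<omega>)" by (intro stoch) auto
    from min_nonzero_entry_bounds[OF this]
    show "- log_minus (min_nonzero_entry (A 1 \<omega>)) = neg_log_min_entry (A 1 \<omega>)"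
      by (simp add: log_minus_def)
  qed
  finally have int: "integrable M (\<lambda>\<omega>. neg_log_min_entry (A 1 \<omega>))" .
  let ?\<rho> = "spec_radius (second_moment ** pair_projection)"
  have eta2: "eta2 = ereal_log ?\<rho>" using assms(13) by (simp only: second_moment_def)
  have "?\<rho> < 1" by (rule spec_radius_second_moment_less_1[of S]; fact)
  then have "eta2 < ereal 0" unfolding eta2 by (subst ereal_log_less_iff) (auto simp: spec_radius_nonneg)
  then have neg: "eta2 / 2 < 0" by (cases eta2) auto
  let ?L = "\<lambda>\<omega>. limsup (\<lambda>n. ereal_log (\<Sum>i\<in>UNIV. \<bar>x n \<omega> $ i / w n \<omega> $ i - xbar\<bar>) / ereal (real n))"
  have bound: "AE \<omega> in M. ?L \<omega> \<le> ereal (\<theta>' / 2)" if \<theta>': "eta2 < ereal \<theta>'" for \<theta>'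
  proof -
    obtain \<theta> where \<theta>: "eta2 < ereal \<theta>" "ereal \<theta> < ereal \<theta>'" using ereal_dense2[OF \<theta>'] by blast
    have "\<theta> < \<theta>'" using \<theta>(2) by simp
    have "?\<rho> < exp \<theta>" using \<theta>(1) unfolding eta2 by (subst (asm) ereal_log_less_iff) (auto simp: spec_radius_nonneg)
    have "AE \<omega> in M. eventually (\<lambda>n. (\<Sum>i\<in>UNIV. \<bar>x n \<omega> $ i / w n \<omega> $ i - xbar\<bar>) \<le> exp (real n * \<theta>' / 2)) sequentially"
      unfolding assms(10,11) by (rule ratio_error_decay[of S \<theta>]; fact)
    then show ?thesis
      by eventually_elim (rule limsup_log_rate_le, simp)
  qed
  \<comment> \<open>rational rates suffice, and only countably many null sets can be discarded\<close>
  have "AE \<omega> in M. \<forall>r :: rat. eta2 < ereal (of_rat r) \<longrightarrow> ?L \<omega> \<le> ereal (of_rat r / 2)"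
    unfolding AE_all_countable using bound by (intro allI AE_impI) 
  then have "AE \<omega> in M. ?L \<omega> \<le> eta2 / 2"
  proof eventually_elim
    case (elim \<omega>)
    show ?case
    proof (rule ccontr)
      assume "\<not> ?L \<omega> \<le> eta2 / 2"
      then have "eta2 / 2 < ?L \<omega>" by simp
      then obtain b where b: "eta2 / 2 < ereal b" "ereal b < ?L \<omega>" using ereal_dense2 by blast
      from b(1) obtain a where a: "eta2 / 2 < ereal a" "ereal a < ereal b" using ereal_dense2 by blast
      then obtain r where r: "2 * a < of_rat r" "of_rat r < 2 * b" using of_rat_dense[of "2 * a" "2 * b"] by auto
      have "eta2 < ereal (of_rat r)" using a(1) r(1) by (cases eta2) auto
      with elim have "?L \<omega> \<le> ereal (of_rat r / 2)" by blast
      also have "\<dots> < ereal b" using r(2) by simp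
      finally show False using b(2) by (simp add: less_le_not_le)
    qed
  qed
  with neg show ?thesis by blast
qed

end
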